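(* Let $A_1$ and $A_2$ be unital $C^*$-algebras and let $\phi\colon A_{1+}^{-1}\to A_{2+}^{-1}$ be a surjection. Suppose that $\|\phi(y)\phi(x)\phi(y)\|=\|yxy\|$ for all $x,y\in A_{1+}^{-1}$. Then there exists a Jordan $*$-isomorphism $J\colon A_1\to A_2$ such that $\phi=J$ on $A_{1+}^{-1}$. Conversely, every Jordan $*$-isomorphism $J\colon A_1\to A_2$ satisfies $\|J(y)J(x)J(y)\|=\|yxy\|$ for all $x,y\in A_{1+}^{-1}$.
   Context: For a unital $C^*$-algebra $A$, $A_+^{-1}$ denotes the positive definite cone of $A$, i.e. the set of all positive invertible elements of $A$; $A_{j+}^{-1}$ denotes this cone for $A=A_j$. A Jordan $*$-isomorphism $J\colon A_1\to A_2$ is a complex linear bijection that preserves the Jordan product $(ab+ba)/2$ and the involution. *)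

theory Defs
  imports Complex_Main
begin

class scaleC = scaleR +
  fixes scaleC :: "complex \<Rightarrow> 'a \<Rightarrow> 'a"  (infixr "*\<^sub>C" 75)

class involution =
  fixes star :: "'a \<Rightarrow> 'a"

text \<open>
  The norm and the completeness come from the real Banach algebra structure
  of the library, whose scalar multiplication is required to be the restriction of the complex
  one.  The class \<^class>\<open>real_normed_algebra_1\<close> contains the usual normalisation
  \<^prop>\<open>norm 1 = 1\<close>, so the algebra is nonzero.
\<close>

class unital_cstar_algebra = real_normed_algebra_1 + banach + scaleC + involution +
  assumes scaleR_eq_scaleC: "r *\<^sub>R a = complex_of_real r *\<^sub>C a"
    and scaleC_add_right: "c *\<^sub>C (a + b) = c *\<^sub>C a + c *\<^sub>C b"
    and scaleC_add_left: "(c + d) *\<^sub>C a = c *\<^sub>C a + d *\<^sub>C a"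
    and scaleC_scaleC: "c *\<^sub>C (d *\<^sub>C a) = (c * d) *\<^sub>C a"
    and scaleC_one: "1 *\<^sub>C a = a"
    and mult_scaleC_left: "(c *\<^sub>C a) * b = c *\<^sub>C (a * b)"
    and mult_scaleC_right: "a * (c *\<^sub>C b) = c *\<^sub>C (a * b)"
    and norm_scaleC: "norm (c *\<^sub>C a) = cmod c * norm a"
    and star_add: "star (a + b) = star a + star b"
    and star_scaleC: "star (c *\<^sub>C a) = cnj c *\<^sub>C star a"
    and star_mult: "star (a * b) = star b * star a"
    and star_star: "star (star a) = a"
    and cstar_identity: "norm (star a * a) = (norm a)\<^sup>2"

definition invertible_elem :: "'a::monoid_mult \<Rightarrow> bool" where
  "invertible_elem a \<longleftrightarrow> (\<exists>b. a * b = 1 \<and> b * a = 1)"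

definition cstar_spectrum :: "'a::unital_cstar_algebra \<Rightarrow> complex set" where
  "cstar_spectrum a = {c. \<not> invertible_elem (a - c *\<^sub>C 1)}"

definition cstar_positive :: "'a::unital_cstar_algebra \<Rightarrow> bool" where
  "cstar_positive a \<longleftrightarrow> star a = a \<and> cstar_spectrum a \<subseteq> complex_of_real ` {0..}"

definition pos_def_cone :: "'a::unital_cstar_algebra set" where
  "pos_def_cone = {a. cstar_positive a \<and> invertible_elem a}"

definition jordan_product :: "'a::unital_cstar_algebra \<Rightarrow> 'a \<Rightarrow> 'a" where
  "jordan_product a b = (1 / 2) *\<^sub>C (a * b + b * a)"

definition jordan_star_iso ::
    "('a::unital_cstar_algebra \<Rightarrow> 'b::unital_cstar_algebra) \<Rightarrow> bool" where
  "jordan_star_iso J \<longleftrightarrow>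
     bij J \<and>
     (\<forall>a b. J (a + b) = J a + J b) \<and>
     (\<forall>c a. J (c *\<^sub>C a) = c *\<^sub>C J a) \<and>
     (\<forall>a b. J (jordan_product a b) = jordan_product (J a) (J b)) \<and>
     (\<forall>a. J (star a) = star (J a))"

end

(*
  A norm-defined positivity notion (x is selfadjoint with |t - x| <= t for some t) gives square
  roots by an elementary iteration and makes the spectral radius formula and the functional
  calculus unnecessary.

  For x, y in the cone, |yxy| <= c means x <= c y^-2. Since every element of the cone is of the
  form y^-2, a norm preserver phi is a unital, positively homogeneous order isomorphism of the
  cones with phi(y^-2) = phi(y)^-2, hence phi(y^4) = phi(y)^4. The fourth power rule forces the
  quotients 4^n (phi(1 + 4^-n h) - 1) to converge for selfadjoint h. The limit f is monotone and
  commutes with adding scalars, so it is an isometry of the selfadjoint parts (its inverse comes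
  from phi^-1); by Mazur-Ulam it is linear. Kadison's inequality for f and its inverse yields
  f(h^2) = f(h)^2. Finally phi = f, because phi and f agree to second order at the unit and
  both commute with the extraction of 4^n-th roots.
*)
theory Submission
  imports Defs
begin

section \<open>The involution\<close>

text \<open>Nothing linear is known about \<open>\<phi>\<close> at the outset, so linearity is
  sought at the unit, where order and homogeneity alone already force a Lipschitz bound. The
  derivative exists because \<open>1 + 4 y\<close> and \<open>(1 + y)^4\<close> differ by a term of
  order \<open>norm y ^ 2\<close>: the power rule therefore makes the difference quotients at the
  scales \<open>4^-n\<close> and \<open>4^-(n+1)\<close> differ by a geometrically small amount. The
  exponent 4 is what two uses of the inverse square rule provide, and it dictates the scales
  \<open>4^-n\<close> throughout. Kadison's inequality is usually read off a spectral resolution.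
  Bernstein operators supply a finite substitute: commuting nonnegative weights built from
  \<open>h\<close> and \<open>1 - h\<close>. The derivative is handled on selfadjoint elements until
  the final complex extension. The spectrum of the definitions is met only in
  \<open>pos_def_cone_iff\<close>, where a connectedness argument takes the place of spectral
  calculus. For the converse, \<open>y * x * y\<close> is a Jordan polynomial, and the norm of a
  selfadjoint element is determined by the order.\<close>

lemma star_scaleR: "star (r *\<^sub>R a) = r *\<^sub>R star (a::'a::unital_cstar_algebra)"
  by (simp add: scaleR_eq_scaleC star_scaleC)

lemma star_zero [simp]: "star (0::'a::unital_cstar_algebra) = 0"
  using star_scaleR[of 0 "0::'a"] by simp

lemma star_minus: "star (- a) = - star (a::'a::unital_cstar_algebra)"
  using star_scaleR[of "-1" a] by simp

lemma star_diff: "star (a - b) = star a - star (b::'a::unital_cstar_algebra)"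
  using star_add[of a "- b"] by (simp add: star_minus)

lemma star_one [simp]: "star (1::'a::unital_cstar_algebra) = 1"
  by (metis star_mult star_star mult_1)

lemma star_of_real [simp]: "star (of_real r :: 'a::unital_cstar_algebra) = of_real r"
  by (simp add: of_real_def star_scaleR)

lemma star_power: "star (a ^ n) = star (a::'a::unital_cstar_algebra) ^ n"
  by (induction n) (simp_all add: star_mult power_commutes)

lemma norm_star [simp]: "norm (star a) = norm (a::'a::unital_cstar_algebra)"
proof -
  have le: "norm b \<le> norm (star b)" for b :: 'a
  proof (cases "b = 0")
    case False
    have "norm b * norm b \<le> norm (star b) * norm b"
      using cstar_identity[of b] norm_mult_ineq[of "star b" b] by (simp add: power2_eq_square)
    then show ?thesis using False by simp
  qed simp
  show ?thesis using le[of a] le[of "star a"] by (simp add: star_star)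
qed

lemma bounded_linear_star: "bounded_linear (star :: 'a::unital_cstar_algebra \<Rightarrow> 'a)"
  by (rule bounded_linear_intro[of _ 1]) (simp_all add: star_add star_scaleR)

lemma tendsto_star: "(f \<longlongrightarrow> (l::'a::unital_cstar_algebra)) F \<Longrightarrow> ((\<lambda>x. star (f x)) \<longlongrightarrow> star l) F"
  by (rule bounded_linear.tendsto[OF bounded_linear_star])

lemma star_commuting_product:
  fixes a b :: "'a::unital_cstar_algebra"
  shows "star a = a \<Longrightarrow> star b = b \<Longrightarrow> a * b = b * a \<Longrightarrow> star (a * b) = a * b"
  by (simp add: star_mult)

text \<open>Complex scalars become real scalars plus this one central element, so that identities
  involving them can be normalised inside the real algebra.\<close>

definition imag_unit :: "'a::unital_cstar_algebra" where
  "imag_unit = \<i> *\<^sub>C 1"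

lemma imag_unit_commutes: "a * imag_unit = imag_unit * (a::'a::unital_cstar_algebra)"
  by (simp add: imag_unit_def mult_scaleC_left mult_scaleC_right)

lemma scaleC_minus_one: "(-1) *\<^sub>C a = - (a::'a::unital_cstar_algebra)"
  using scaleR_eq_scaleC[of "-1" a] by simp

lemma imag_unit_square: "imag_unit * imag_unit = (-1 :: 'a::unital_cstar_algebra)"
  by (simp add: imag_unit_def mult_scaleC_left scaleC_scaleC scaleC_minus_one)

lemma imag_unit_square_assoc: "imag_unit * (imag_unit * a) = - (a :: 'a::unital_cstar_algebra)"
  by (simp add: imag_unit_square mult.assoc[symmetric])

lemma star_imag_unit: "star imag_unit = - (imag_unit :: 'a::unital_cstar_algebra)"
proof -
  have "star (imag_unit::'a) = (-1 * \<i>) *\<^sub>C 1"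
    by (simp add: imag_unit_def star_scaleC)
  also have "\<dots> = - imag_unit"
    by (simp only: scaleC_scaleC[symmetric] scaleC_minus_one imag_unit_def)
  finally show ?thesis .
qed

lemma scaleC_eq: "c *\<^sub>C a = Re c *\<^sub>R a + Im c *\<^sub>R (imag_unit * (a::'a::unital_cstar_algebra))"
proof -
  have "c *\<^sub>C a = (complex_of_real (Re c) + complex_of_real (Im c) * \<i>) *\<^sub>C a"
    by (metis complex_eq mult.commute)
  also have "\<dots> = Re c *\<^sub>R a + Im c *\<^sub>R (imag_unit * a)"
    by (simp only: scaleC_add_left scaleC_scaleC[symmetric] scaleR_eq_scaleC imag_unit_def
        mult_scaleC_left mult_1)
  finally show ?thesis .
qed

section \<open>Invertibility\<close>

lemma invertible_elem_mult:
  assumes "invertible_elem (a::'a::monoid_mult)" "invertible_elem b"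
  shows "invertible_elem (a * b)"
proof -
  obtain c d where "a * c = 1" "c * a = 1" "b * d = 1" "d * b = 1"
    using assms by (auto simp: invertible_elem_def)
  then have "a * b * (d * c) = 1" "d * c * (a * b) = 1"
    by (metis mult.assoc mult_1)+
  then show ?thesis unfolding invertible_elem_def by blast
qed

text \<open>Since the factors commute, \<open>b * c\<close> is a right inverse of \<open>a\<close>
  and \<open>c * b\<close> a left inverse; the two then coincide.\<close>

lemma invertible_elem_commuting_factor:
  assumes "invertible_elem (a * b)" "a * b = b * (a::'a::monoid_mult)"
  shows "invertible_elem a"
proof -
  obtain c where c: "a * b * c = 1" "c * (a * b) = 1"
    using assms by (auto simp: invertible_elem_def)
  then have r: "a * (b * c) = 1" and l: "(c * b) * a = 1"
    using assms(2) by (metis mult.assoc)+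
  then have "b * c = c * b" by (metis mult.assoc mult_1 mult.right_neutral)
  then show ?thesis using r l unfolding invertible_elem_def by metis
qed

lemma invertible_elem_scaleR:
  assumes "invertible_elem (a::'a::real_algebra_1)" "r \<noteq> 0"
  shows "invertible_elem (r *\<^sub>R a)"
proof -
  obtain b where "a * b = 1" "b * a = 1"
    using assms by (auto simp: invertible_elem_def)
  then show ?thesis
    using assms(2) unfolding invertible_elem_def by (intro exI[of _ "(1/r) *\<^sub>R b"]) simp
qed

lemma neumann_series:
  assumes "norm (1 - a) < 1"
  shows "invertible_elem (a :: 'a::{real_normed_algebra_1,banach})"
proof -
  define x where "x = 1 - a"
  have s: "summable (\<lambda>n. x ^ n)"
  proof (rule summable_comparison_test)
    show "\<exists>N. \<forall>n\<ge>N. norm (x ^ n) \<le> norm x ^ n" by (simp add: norm_power_ineq)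
    show "summable (\<lambda>n. norm x ^ n)" using assms by (intro summable_geometric) (simp add: x_def)
  qed
  define S where "S = (\<Sum>n. x ^ n)"
  have "S = (\<Sum>n. x ^ Suc n) + 1"
    using suminf_split_head[OF s] by (simp add: S_def)
  moreover have "(\<Sum>n. x ^ Suc n) = x * S" "(\<Sum>n. x ^ Suc n) = S * x"
    using suminf_mult[OF s, of x] suminf_mult2[OF s, of x] by (simp_all add: S_def power_commutes)
  ultimately have "a * S = 1" "S * a = 1"
    unfolding x_def by (simp_all add: algebra_simps)
  then show ?thesis unfolding invertible_elem_def by blast
qed

lemma invertible_elem_near_of_real:
  assumes "norm (of_real t - a) < t"
  shows "invertible_elem (a :: 'a::{real_normed_algebra_1,banach})"
proof -
  have t: "t > 0" using assms norm_ge_zero le_less_trans by blast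
  have "1 - (1/t) *\<^sub>R a = (1/t) *\<^sub>R (of_real t - a)"
    using t by (simp add: of_real_def algebra_simps)
  then have "norm (1 - (1/t) *\<^sub>R a) < 1" using assms t by simp
  from invertible_elem_scaleR[OF neumann_series[OF this], of t] show ?thesis using t by simp
qed

lemma star_inverse:
  fixes a :: "'a::unital_cstar_algebra"
  assumes "star a = a" "a * b = 1" "b * a = 1"
  shows "star b = b"
proof -
  have "star b * a = 1" using arg_cong[OF assms(2), of star] assms(1) by (simp add: star_mult)
  then show ?thesis using assms(2) by (metis mult.assoc mult_1 mult.right_neutral)
qed

section \<open>Nonnegative elements\<close>

text \<open>Defining positivity by norms rather than by the spectrum makes the cone properties
  immediate and avoids the spectral radius formula.\<close>

definition nonneg :: "'a::unital_cstar_algebra \<Rightarrow> bool" where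
  "nonneg x \<longleftrightarrow> star x = x \<and> (\<exists>t. norm (of_real t - x) \<le> t)"

lemma nonneg_star: "nonneg x \<Longrightarrow> star x = x"
  by (simp add: nonneg_def)

lemma nonnegI: "star x = x \<Longrightarrow> norm (of_real t - x) \<le> t \<Longrightarrow> nonneg x"
  unfolding nonneg_def by blast

lemma nonneg_of_real: "nonneg (of_real r :: 'a::unital_cstar_algebra) \<longleftrightarrow> r \<ge> 0"
proof
  assume "nonneg (of_real r :: 'a)"
  then obtain t where "norm (of_real t - of_real r :: 'a) \<le> t" unfolding nonneg_def by blast
  then have "\<bar>t - r\<bar> \<le> t" by (metis norm_of_real of_real_diff)
  then show "r \<ge> 0" by linarith
qed (auto simp: nonneg_def intro!: exI[of _ r])

lemma nonneg_zero: "nonneg 0" and nonneg_one: "nonneg 1"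
  using nonneg_of_real[of 0] nonneg_of_real[of 1] by simp_all

lemma nonneg_add: "nonneg x \<Longrightarrow> nonneg y \<Longrightarrow> nonneg (x + y)"
proof -
  assume "nonneg x" "nonneg y"
  then obtain s t where st: "norm (of_real s - x) \<le> s" "norm (of_real t - y) \<le> t"
    and "star x = x" "star y = y" unfolding nonneg_def by blast
  have "norm (of_real (s + t) - (x + y)) \<le> s + t"
    using norm_triangle_ineq[of "of_real s - x" "of_real t - y"] st by (simp add: algebra_simps)
  then show ?thesis using \<open>star x = x\<close> \<open>star y = y\<close> unfolding nonneg_def star_add by metis
qed

lemma nonneg_scaleR: "nonneg x \<Longrightarrow> r \<ge> 0 \<Longrightarrow> nonneg (r *\<^sub>R x)"
proof -
  assume "nonneg x" "r \<ge> 0"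
  then obtain t where t: "norm (of_real t - x) \<le> t" "star x = x" unfolding nonneg_def by blast
  have "of_real (r * t) - r *\<^sub>R x = r *\<^sub>R (of_real t - x)"
    by (simp add: of_real_def algebra_simps)
  then have "norm (of_real (r * t) - r *\<^sub>R x) \<le> r * t"
    using t \<open>r \<ge> 0\<close> by (simp add: mult_left_mono)
  then show ?thesis using t unfolding nonneg_def star_scaleR by metis
qed

lemma nonneg_of_real_minus:
  "star h = h \<Longrightarrow> norm h \<le> c \<Longrightarrow> nonneg (of_real c - h)"
  by (auto simp: nonneg_def star_diff intro!: exI[of _ c])

lemma nonneg_of_real_plus:
  "star h = h \<Longrightarrow> norm h \<le> c \<Longrightarrow> nonneg (of_real c + h)"
  using nonneg_of_real_minus[of "- h" c] by (simp add: star_minus)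

text \<open>If \<^prop>\<open>norm y \<le> 1\<close>, the iteration \<open>w \<mapsto> (y + w\<^sup>2) / 2\<close> converges to a solution of
  \<open>(1 - w)\<^sup>2 = 1 - y\<close>; it is dominated by the same iteration for the number 1.\<close>

primrec sqrt_iter :: "'a::real_normed_algebra_1 \<Rightarrow> nat \<Rightarrow> 'a" where
  "sqrt_iter y 0 = 0"
| "sqrt_iter y (Suc n) = (1/2) *\<^sub>R (y + sqrt_iter y n * sqrt_iter y n)"

lemma sqrt_iter_commutes: "z * y = y * z \<Longrightarrow> z * sqrt_iter y n = sqrt_iter y n * z"
proof (induction n)
  case (Suc n)
  then show ?case by (simp add: algebra_simps) (metis mult.assoc)
qed simp

lemma sqrt_iter_one_bounds:
  "0 \<le> sqrt_iter (1::real) n \<and> sqrt_iter (1::real) n \<le> sqrt_iter (1::real) (Suc n) \<and> sqrt_iter (1::real) n \<le> 1"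
proof (induction n)
  case (Suc n)
  let ?r = "sqrt_iter (1::real)"
  have "?r n * ?r n \<le> ?r (Suc n) * ?r (Suc n)" using Suc by (intro mult_mono) auto
  moreover have "?r n * ?r n \<le> 1" using Suc by (simp add: mult_le_one)
  ultimately show ?case using Suc by (simp)
qed simp

lemma norm_sqrt_iter_le:
  assumes "norm y \<le> 1"
  shows "norm (sqrt_iter y n) \<le> sqrt_iter 1 n"
proof (induction n)
  case (Suc n)
  have "norm (sqrt_iter y n * sqrt_iter y n) \<le> sqrt_iter 1 n * sqrt_iter 1 n"
    by (rule order_trans[OF norm_mult_ineq]) (intro mult_mono Suc, auto simp: sqrt_iter_one_bounds)
  then have "norm (y + sqrt_iter y n * sqrt_iter y n) \<le> 1 + sqrt_iter 1 n * sqrt_iter 1 n"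
    using norm_triangle_ineq[of y "sqrt_iter y n * sqrt_iter y n"] assms by linarith
  then show ?case by simp
qed simp

text \<open>Successive iterates commute, so the difference of their squares factors; the same
  factorisation for the number 1 dominates it factor by factor.\<close>

lemma norm_sqrt_iter_diff_le:
  assumes "norm y \<le> 1"
  shows "norm (sqrt_iter y (Suc n) - sqrt_iter y n) \<le> sqrt_iter 1 (Suc n) - sqrt_iter 1 n"
proof (induction n)
  case (Suc n)
  let ?w = "sqrt_iter y" and ?r = "sqrt_iter (1::real)"
  have comm: "?w n * ?w (Suc n) = ?w (Suc n) * ?w n"
    by (intro sqrt_iter_commutes sqrt_iter_commutes[symmetric] refl)
  have "?w (Suc (Suc n)) - ?w (Suc n)
      = (1/2) *\<^sub>R (?w (Suc n) * ?w (Suc n) - ?w n * ?w n)"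
    by (subst (1 2) sqrt_iter.simps(2)) (simp add: algebra_simps del: sqrt_iter.simps)
  also have "?w (Suc n) * ?w (Suc n) - ?w n * ?w n
      = (?w (Suc n) + ?w n) * (?w (Suc n) - ?w n)"
    using comm by (simp add: algebra_simps del: sqrt_iter.simps)
  finally have "norm (?w (Suc (Suc n)) - ?w (Suc n))
      \<le> 1/2 * (norm (?w (Suc n) + ?w n) * norm (?w (Suc n) - ?w n))"
    using norm_mult_ineq[of "?w (Suc n) + ?w n" "?w (Suc n) - ?w n"]
    by (simp del: sqrt_iter.simps)
  also have "\<dots> \<le> 1/2 * ((?r (Suc n) + ?r n) * (?r (Suc n) - ?r n))"
  proof (intro mult_left_mono mult_mono Suc)
    show "norm (?w (Suc n) + ?w n) \<le> ?r (Suc n) + ?r n"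
      using norm_triangle_ineq[of "?w (Suc n)" "?w n"] norm_sqrt_iter_le[OF assms, of n]
        norm_sqrt_iter_le[OF assms, of "Suc n"] by linarith
    show "0 \<le> ?r (Suc n) + ?r n" using sqrt_iter_one_bounds[of n] by linarith
  qed auto
  also have "\<dots> = ?r (Suc (Suc n)) - ?r (Suc n)"
    by (subst (1 2) sqrt_iter.simps(2)) (simp add: algebra_simps del: sqrt_iter.simps)
  finally show ?case .
qed (use assms in simp)

text \<open>Commutation with everything that commutes with \<open>x\<close> passes from the iterates
  to the limit. It stands in for the functional calculus when roots of commuting elements are
  multiplied.\<close>

lemma sqrt_near_one:
  fixes x :: "'a::unital_cstar_algebra"
  assumes x: "star x = x" "norm (1 - x) \<le> 1"
  obtains s where "star s = s" "norm (1 - s) \<le> 1" "s * s = x"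
    "\<And>z. z * x = x * z \<Longrightarrow> z * s = s * z"
proof -
  define y where "y = 1 - x"
  let ?w = "sqrt_iter y" and ?r = "sqrt_iter (1::real)"
  have y: "norm y \<le> 1" "star y = y" using x by (simp_all add: y_def star_diff)
  have tele: "norm (?w (n + k) - ?w n) \<le> ?r (n + k) - ?r n" for n k
  proof (induction k)
    case (Suc k)
    show ?case
      using Suc norm_sqrt_iter_diff_le[OF y(1), of "n + k"]
        norm_triangle_ineq[of "?w (Suc (n + k)) - ?w (n + k)" "?w (n + k) - ?w n"]
      by (simp del: sqrt_iter.simps)
  qed simp
  have "convergent ?r"
  proof (rule Bseq_monoseq_convergent)
    show "Bseq ?r" using sqrt_iter_one_bounds by (intro BseqI'[of _ 1]) auto
    show "monoseq ?r" using sqrt_iter_one_bounds by (intro incseq_imp_monoseq incseq_SucI) blast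
  qed
  then have cr: "Cauchy ?r" by (rule convergent_Cauchy)
  have "Cauchy ?w"
  proof (rule metric_CauchyI)
    fix e :: real assume "e > 0"
    then obtain M where M: "\<And>m n. m \<ge> M \<Longrightarrow> n \<ge> M \<Longrightarrow> dist (?r m) (?r n) < e"
      using metric_CauchyD[OF cr] by blast
    have ord: "dist (?w m) (?w n) < e" if "n \<ge> M" "m \<ge> n" for m n
      using tele[of n "m - n"] M[of m n] that by (simp add: dist_norm)
    have "dist (?w m) (?w n) < e" if "n \<ge> M" "m \<ge> M" for m n
      using ord[of n m] ord[of m n] that by (metis dist_commute le_cases)
    then show "\<exists>M. \<forall>m\<ge>M. \<forall>n\<ge>M. dist (?w m) (?w n) < e" by blast
  qed
  then obtain w where w: "?w \<longlonglongrightarrow> w" using Cauchy_convergent convergentD by blast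
  have "(\<lambda>n. ?w (Suc n)) \<longlonglongrightarrow> (1/2) *\<^sub>R (y + w * w)"
    unfolding sqrt_iter.simps by (intro tendsto_intros w)
  then have lim: "w = (1/2) *\<^sub>R (y + w * w)" using LIMSEQ_Suc[OF w] LIMSEQ_unique by blast
  have two: "w + w = y + w * w" by (metis lim scaleR_half_double scaleR_right_distrib)
  show ?thesis
  proof (rule that[of "1 - w"])
    have "star (?w n) = ?w n" for n by (induction n) (simp_all add: star_scaleR star_add star_mult y)
    then have "?w \<longlonglongrightarrow> star w" using tendsto_star[OF w] by simp
    then have "star w = w" using w by (rule LIMSEQ_unique)
    then show "star (1 - w) = 1 - w" by (simp add: star_diff)
    have "norm (?w n) \<le> 1" for n
      using norm_sqrt_iter_le[OF y(1), of n] sqrt_iter_one_bounds[of n] by linarith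
    then show "norm (1 - (1 - w)) \<le> 1" using Lim_bounded[OF tendsto_norm[OF w]] by simp
    have "(1 - w) * (1 - w) = 1 - (w + w) + w * w" by (simp add: algebra_simps)
    then show "(1 - w) * (1 - w) = x" unfolding two by (simp add: y_def)
    fix z assume "z * x = x * z"
    then have "z * y = y * z" by (simp add: y_def algebra_simps)
    then have eq: "z * ?w n = ?w n * z" for n by (rule sqrt_iter_commutes)
    have "z * w = w * z"
      using tendsto_mult_left[OF w, of z] tendsto_mult_right[OF w, of z]
      unfolding eq by (rule LIMSEQ_unique)
    then show "z * (1 - w) = (1 - w) * z" by (simp add: algebra_simps)
  qed
qed

lemma nonneg_sqrt:
  assumes "nonneg x"
  obtains s where "nonneg s" "s * s = x" "\<And>z. z * x = x * z \<Longrightarrow> z * s = s * z"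
proof -
  obtain t where t: "norm (of_real t - x) \<le> t" "star x = x" using assms unfolding nonneg_def by blast
  show ?thesis
  proof (cases "t = 0")
    case True
    then have "x = 0" using t by simp
    then show ?thesis by (intro that[of 0]) (simp_all add: nonneg_zero)
  next
    case False
    then have tp: "t > 0" using t norm_ge_zero order_trans by (metis order_le_less)
    define y where "y = (1/t) *\<^sub>R x"
    have "1 - y = (1/t) *\<^sub>R (of_real t - x)"
      using tp by (simp add: y_def of_real_def algebra_simps)
    then have "norm (1 - y) \<le> 1" using t tp by simp
    moreover have "star y = y" using t by (simp add: y_def star_scaleR)
    ultimately obtain s where s: "star s = s" "norm (1 - s) \<le> 1" "s * s = y"
      "\<And>z. z * y = y * z \<Longrightarrow> z * s = s * z" using sqrt_near_one[of y] by metis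
    show ?thesis
    proof (rule that[of "sqrt t *\<^sub>R s"])
      have "nonneg s" using s(1,2) unfolding nonneg_def by (intro conjI exI[of _ 1]) simp_all
      then show "nonneg (sqrt t *\<^sub>R s)" using tp by (intro nonneg_scaleR) simp_all
      show "sqrt t *\<^sub>R s * sqrt t *\<^sub>R s = x" using s(3) tp by (simp add: y_def)
      show "z * sqrt t *\<^sub>R s = sqrt t *\<^sub>R s * z" if "z * x = x * z" for z
        using s(4)[of z] that by (auto simp: y_def)
    qed
  qed
qed

text \<open>Here \<open>c + i v\<close> is unitary.\<close>

lemma norm_le_one_of_circle:
  fixes c v :: "'a::unital_cstar_algebra"
  assumes "star c = c" "star v = v" "c * v = v * c" "c * c + v * v = 1"
  shows "norm c \<le> 1"
proof -
  define u where "u = c + imag_unit * v"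
  have su: "star u = c - imag_unit * v"
    by (simp add: u_def star_add star_mult star_imag_unit imag_unit_commutes assms(1,2))
  have "v * imag_unit = imag_unit * v" "c * imag_unit = imag_unit * c"
    by (rule imag_unit_commutes)+
  then have "imag_unit * v * (imag_unit * v) = - (v * v)" "c * (imag_unit * v) = imag_unit * v * c"
    using assms(3) by (metis mult.assoc imag_unit_square_assoc mult_minus_right, metis mult.assoc)
  then have "star u * u = c * c + v * v"
    unfolding su by (simp add: u_def algebra_simps)
  then have "norm u = 1"
    using cstar_identity[of u] assms(4) norm_ge_zero[of u] by (auto simp: power2_eq_1_iff)
  moreover have "c = (1/2) *\<^sub>R (u + star u)" by (unfold su, simp add: u_def scaleR_2[symmetric])
  ultimately show ?thesis using norm_triangle_ineq[of u "star u"] by simp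
qed

text \<open>With \<open>norm d \<le> 1\<close>, a root \<open>v\<close> of \<open>1 - d * d\<close>
  commutes with \<open>d\<close>, and \<open>d * d + v * v = 1\<close>. The circle lemma, with the
  roles exchanged, bounds \<open>v\<close>; hence \<open>norm (1 - d * d) \<le> 1\<close>, and 1 is
  the witness required by \<open>nonneg\<close>.\<close>

lemma nonneg_square:
  assumes "star c = c"
  shows "nonneg (c * c)"
proof (cases "c = 0")
  case False
  define d where "d = (1 / norm c) *\<^sub>R c"
  have d: "star d = d" "norm d \<le> 1" using assms False by (simp_all add: d_def star_scaleR)
  have "norm (1 - (1 - d * d)) \<le> 1" using norm_mult_ineq[of d d] d(2)
    by (simp add: order_trans mult_le_one)
  moreover have "star (1 - d * d) = 1 - d * d" by (simp add: star_diff star_mult d)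
  ultimately obtain v where v: "star v = v" "v * v = 1 - d * d"
    "\<And>z. z * (1 - d * d) = (1 - d * d) * z \<Longrightarrow> z * v = v * z"
    using sqrt_near_one by metis
  have "d * v = v * d" by (rule v(3)) (simp add: algebra_simps)
  then have "norm v \<le> 1" using norm_le_one_of_circle[of v d] v(1,2) d by simp
  then have "norm (of_real 1 - d * d) \<le> 1"
    using norm_mult_ineq[of v v] v(2) by (simp add: order_trans mult_le_one)
  then have "nonneg (d * d)" using d by (intro nonnegI[of _ 1]) (simp_all add: star_mult)
  from nonneg_scaleR[OF this, of "norm c * norm c"] show ?thesis using False by (simp add: d_def)
qed (simp add: nonneg_zero)

text \<open>Two uses of the commutation clause show that the roots commute with each other, so
  \<open>x * y\<close> is the square of the selfadjoint element \<open>s * t\<close>.\<close>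

lemma nonneg_mult:
  assumes "nonneg x" "nonneg y" "x * y = y * x"
  shows "nonneg (x * y)"
proof -
  obtain s where s: "nonneg s" "s * s = x" "\<And>z. z * x = x * z \<Longrightarrow> z * s = s * z"
    using nonneg_sqrt[OF assms(1)] by metis
  obtain t where t: "nonneg t" "t * t = y" "\<And>z. z * y = y * z \<Longrightarrow> z * t = t * z"
    using nonneg_sqrt[OF assms(2)] by metis
  have "s * y = y * s" using s(3) assms(3) by metis
  then have st: "s * t = t * s" using t(3) by metis
  then have "(s * t) * (s * t) = x * y" using s(2) t(2) by (metis mult.assoc)
  moreover have "star (s * t) = s * t"
    using st s(1) t(1) by (simp add: star_mult nonneg_star)
  ultimately show ?thesis using nonneg_square by metis
qed

text \<open>Together with \<open>nonneg_of_real_minus\<close> and \<open>nonneg_of_real_plus\<close>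
  this identifies the norm of selfadjoint elements with the order norm. For \<open>k\<close> between
  -1 and 1, the product \<open>(1 - k) * (1 + k)\<close> is nonnegative and has a root commuting
  with \<open>k\<close>, so the circle lemma bounds \<open>k\<close>.\<close>

lemma norm_le_of_nonneg:
  fixes h :: "'a::unital_cstar_algebra"
  assumes h: "nonneg (of_real c - h)" "nonneg (of_real c + h)"
  shows "norm h \<le> c"
proof -
  have "of_real c - h + (of_real c + h) = of_real (c + c)" unfolding of_real_add by simp
  then have "nonneg (of_real (c + c) :: 'a)" using nonneg_add[OF h] by metis
  then have c0: "c \<ge> 0" unfolding nonneg_of_real by simp
  have "star (of_real c + h) = of_real c + h" using h(2) nonneg_star by blast
  then have sh: "star h = h" by (simp add: star_add)
  \<comment> \<open>\<open>c\<close> may be 0, so the normalisation divides by a larger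
    \<open>d\<close>, and \<open>dense_ge\<close> removes the excess.\<close>
  have pos: "norm h \<le> d" if d: "d > c" for d
  proof -
    have dp: "d > 0" using c0 d by simp
    define k where "k = (1/d) *\<^sub>R h"
    have "nonneg (of_real d - of_real c :: 'a)" using d nonneg_of_real[of "d - c"] by simp
    then have "nonneg (of_real d - h)" "nonneg (of_real d + h)"
      using nonneg_add[OF h(1), of "of_real d - of_real c"]
        nonneg_add[OF h(2), of "of_real d - of_real c"] by (simp_all add: algebra_simps)
    from nonneg_scaleR[OF this(1), of "1/d"] nonneg_scaleR[OF this(2), of "1/d"]
    have "nonneg (1 - k)" "nonneg (1 + k)"
      using dp by (simp_all add: k_def scaleR_diff_right scaleR_add_right of_real_def)
    then have "nonneg ((1 - k) * (1 + k))" by (intro nonneg_mult) (simp_all add: algebra_simps)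
    then have "nonneg (1 - k * k)" by (simp add: algebra_simps)
    then obtain v where v: "nonneg v" "v * v = 1 - k * k"
      "\<And>z. z * (1 - k * k) = (1 - k * k) * z \<Longrightarrow> z * v = v * z" using nonneg_sqrt by metis
    have "k * v = v * k" by (rule v(3)) (simp add: algebra_simps)
    moreover have "star k = k" using sh by (simp add: k_def star_scaleR)
    ultimately have "norm k \<le> 1"
      using v(1,2) by (intro norm_le_one_of_circle[of k v]) (simp_all add: nonneg_star)
    then show ?thesis using dp by (simp add: k_def)
  qed
  show ?thesis by (rule dense_ge[OF pos])
qed

section \<open>Order, norm and topology of the nonnegative cone\<close>

lemma norm_nonneg_le_iff:
  assumes "nonneg x" "c \<ge> 0"
  shows "norm x \<le> c \<longleftrightarrow> nonneg (of_real c - x)"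
  using nonneg_of_real_minus[of x c] norm_le_of_nonneg[of c x] assms
    nonneg_add[OF assms(1), of "of_real c"]
  by (auto simp: nonneg_star nonneg_of_real add.commute)

lemma nonneg_antisym: "nonneg x \<Longrightarrow> nonneg (- x) \<Longrightarrow> x = 0"
  using norm_le_of_nonneg[of 0 x] by simp

text \<open>Half the norm is a canonical witness, the midpoint of the order interval from 0 to
  \<open>norm x\<close>. Replacing the existential by it turns nonnegativity into a closed
  condition.\<close>

lemma nonneg_iff:
  "nonneg x \<longleftrightarrow> star x = x \<and> norm (of_real (norm x / 2) - x) \<le> norm x / 2"
proof
  assume x: "nonneg x"
  then have "nonneg (of_real (norm x) - x)" by (intro nonneg_of_real_minus) (simp_all add: nonneg_star)
  then have "norm (of_real (norm x / 2) - x) \<le> norm x / 2"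
    using x by (intro norm_le_of_nonneg) (simp_all add: of_real_def algebra_simps flip: scaleR_add_left)
  then show "star x = x \<and> norm (of_real (norm x / 2) - x) \<le> norm x / 2"
    using x by (simp add: nonneg_star)
qed (blast intro: nonnegI)

lemma closed_nonneg: "closed {x. nonneg x}"
  unfolding nonneg_iff
  by (intro closed_Collect_conj closed_Collect_eq closed_Collect_le continuous_intros
      bounded_linear.continuous_on[OF bounded_linear_star] continuous_on_of_real) auto

lemma nonneg_limit:
  assumes "(f \<longlongrightarrow> x) F" "eventually (\<lambda>n. nonneg (f n)) F" "F \<noteq> bot"
  shows "nonneg x"
  using Lim_in_closed_set[OF closed_nonneg _ assms(3,1)] assms(2) by simp

text \<open>\<open>1 - d *\<^sub>R b\<close> is nonnegative because \<open>d\<close> is the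
  reciprocal of \<open>norm b\<close>; multiplying by the commuting element \<open>x\<close> gives
  the bound.\<close>

lemma nonneg_invertible_bounded_below:
  assumes "nonneg x" "x * b = 1" "b * x = 1"
  obtains d where "d > 0" "nonneg (x - of_real d)"
proof -
  have b0: "b \<noteq> 0" using assms(2) by auto
  define d where "d = 1 / norm b"
  have d: "d > 0" using b0 by (simp add: d_def)
  have "star b = b" using star_inverse assms nonneg_star by metis
  then have "nonneg (of_real 1 - d *\<^sub>R b)"
    by (intro nonneg_of_real_minus) (simp_all add: star_scaleR d_def)
  then have "nonneg (x * (1 - d *\<^sub>R b))"
    using assms by (intro nonneg_mult) (simp_all add: algebra_simps)
  then have "nonneg (x - of_real d)" using assms by (simp add: algebra_simps of_real_def)
  then show ?thesis using d that by blast
qed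

lemma nonneg_plus_invertible:
  assumes "nonneg x" "r > 0"
  shows "invertible_elem (x + of_real r)"
proof -
  obtain t where t: "norm (of_real t - x) \<le> t" using assms unfolding nonneg_def by blast
  have "of_real (t + r) - (x + of_real r) = of_real t - x" by simp
  then have "norm (of_real (t + r) - (x + of_real r)) < t + r" using t assms(2) by simp
  then show ?thesis by (rule invertible_elem_near_of_real)
qed

lemma nonneg_interior:
  assumes "nonneg x" "invertible_elem x"
  obtains e where "e > 0" "\<And>z. star z = z \<Longrightarrow> norm (z - x) < e \<Longrightarrow> nonneg z"
proof -
  obtain d where d: "d > 0" "nonneg (x - of_real d)"
    using assms nonneg_invertible_bounded_below unfolding invertible_elem_def by metis
  have "nonneg z" if "star z = z" "norm (z - x) < d" for z
  proof -
    have "nonneg (of_real d + (z - x))"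
      using that nonneg_star[OF assms(1)] by (intro nonneg_of_real_plus) (simp_all add: star_diff)
    from nonneg_add[OF d(2) this] show ?thesis by simp
  qed
  then show ?thesis using d that by blast
qed

text \<open>Nonnegativity is open and closed among the invertible selfadjoint elements.\<close>

lemma nonneg_path:
  fixes p :: "real \<Rightarrow> 'a::unital_cstar_algebra"
  assumes cont: "continuous_on {0..1} p"
    and sa: "\<And>t. t \<in> {0..1} \<Longrightarrow> star (p t) = p t"
    and inv: "\<And>t. t \<in> {0..<1} \<Longrightarrow> invertible_elem (p t)"
    and start: "nonneg (p 0)"
  shows "nonneg (p 1)"
proof -
  let ?S = "{0..<1::real}"
  have loc: "eventually (\<lambda>u. nonneg (p t) = nonneg (p u)) (at t within ?S)" if t: "t \<in> ?S" for t
  proof -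
    have "continuous_on ?S p" by (rule continuous_on_subset[OF cont]) auto
    then have lim: "(p \<longlongrightarrow> p t) (at t within ?S)" using t by (simp add: continuous_on_def)
    have in_S: "eventually (\<lambda>u. u \<in> ?S) (at t within ?S)" by (simp add: eventually_at_filter)
    show ?thesis
    proof (cases "nonneg (p t)")
      case True
      then obtain e where e: "e > 0" "\<And>z. star z = z \<Longrightarrow> norm (z - p t) < e \<Longrightarrow> nonneg z"
        using nonneg_interior inv[OF t] by metis
      show ?thesis using tendstoD[OF lim e(1)] in_S
        by eventually_elim (use True e(2) sa in \<open>auto simp: dist_norm\<close>)
    next
      case False
      have "eventually (\<lambda>u. p u \<in> - {x. nonneg x}) (at t within ?S)"
        using topological_tendstoD[OF lim, of "- {x. nonneg x}"] False
        by (simp add: open_Compl closed_nonneg)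
      then show ?thesis by eventually_elim (use False in auto)
    qed
  qed
  have all: "nonneg (p t)" if "t \<in> ?S" for t
  proof -
    have "nonneg (p 0) = nonneg (p t)"
      by (rule connected_local_const[of ?S 0 t "\<lambda>t. nonneg (p t)"]) (use that loc in auto)
    then show ?thesis using start by simp
  qed
  \<comment> \<open>Invertibility is assumed only before the endpoint, where \<open>p\<close> may
    degenerate; nonnegativity reaches \<open>p 1\<close> as a limit.\<close>
  have "(\<lambda>n. p (real n / real (Suc n))) \<longlonglongrightarrow> p 1"
    by (rule continuous_on_tendsto_compose[OF cont LIMSEQ_n_over_Suc_n]) auto
  then show ?thesis by (rule nonneg_limit) (intro always_eventually allI all, auto)
qed

text \<open>This is the reality of the spectrum of a selfadjoint element: multiplied by its adjoint,
  the element becomes \<open>y * y\<close> plus the positive scalar \<open>r * r\<close>, which is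
  invertible because squares are nonnegative.\<close>

lemma invertible_plus_imag:
  assumes "star y = y" "r \<noteq> 0"
  shows "invertible_elem (y + r *\<^sub>R imag_unit)"
proof -
  have i: "y * imag_unit = imag_unit * y" by (rule imag_unit_commutes)
  have 1: "(y + r *\<^sub>R imag_unit) * (y - r *\<^sub>R imag_unit) = y * y + of_real (r * r)"
    and 2: "(y - r *\<^sub>R imag_unit) * (y + r *\<^sub>R imag_unit) = y * y + of_real (r * r)"
    by (simp_all add: algebra_simps i imag_unit_square) (simp_all add: of_real_def)
  have "invertible_elem (y * y + of_real (r * r))"
    using assms by (intro nonneg_plus_invertible nonneg_square) (auto simp: zero_less_mult_iff)
  then show ?thesis using 1 2 invertible_elem_commuting_factor by metis
qed

text \<open>For \<open>0 \<le> t < 1\<close> the element \<open>z = t y + (1 - t) i\<close> is invertible, and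
  \<open>z\<^sup>* x z\<close> connects \<open>x\<close> with \<open>y x y\<close>.\<close>

lemma nonneg_conj_invertible:
  assumes x: "nonneg x" "invertible_elem x" and y: "star y = y"
  shows "nonneg (y * x * y)"
proof -
  define p where "p = (\<lambda>t. (t *\<^sub>R y - (1 - t) *\<^sub>R imag_unit) * x * (t *\<^sub>R y + (1 - t) *\<^sub>R imag_unit))"
  have "nonneg (p 1)"
  proof (rule nonneg_path)
    show "continuous_on {0..1} p" unfolding p_def by (intro continuous_intros)
    show "star (p t) = p t" for t
      using nonneg_star[OF x(1)] y
      by (simp add: p_def star_mult star_add star_diff star_scaleR star_imag_unit mult.assoc)
    show "invertible_elem (p t)" if t: "t \<in> {0..<1}" for t
    proof -
      have "star (t *\<^sub>R y) = t *\<^sub>R y" using y by (simp add: star_scaleR)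
      then have "invertible_elem (t *\<^sub>R y + (1 - t) *\<^sub>R imag_unit)"
        "invertible_elem (t *\<^sub>R y + (- (1 - t)) *\<^sub>R imag_unit)"
        using t by (intro invertible_plus_imag; simp)+
      then show ?thesis using x(2) unfolding p_def scaleR_minus_left diff_conv_add_uminus
        by (intro invertible_elem_mult)
    qed
    have "imag_unit * x * imag_unit = - x"
      by (metis imag_unit_commutes imag_unit_square_assoc mult.assoc)
    then show "nonneg (p 0)" using x(1) by (simp add: p_def)
  qed
  then show ?thesis by (simp add: p_def)
qed

text \<open>Adding \<open>1 / (n + 1)\<close> makes \<open>x\<close> invertible, and the cone is
  closed.\<close>

lemma nonneg_conj:
  assumes "nonneg x" "star y = y"
  shows "nonneg (y * x * y)"
proof (rule nonneg_limit)
  let ?f = "\<lambda>n. y * (x + of_real (inverse (real (Suc n)))) * y"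
  have "?f \<longlonglongrightarrow> y * (x + of_real 0) * y"
    by (intro tendsto_intros LIMSEQ_inverse_real_of_nat)
  then show "?f \<longlonglongrightarrow> y * x * y" by simp
  have "nonneg (?f n)" for n
    using assms nonneg_of_real[of "inverse (real (Suc n))", where 'a='a]
    by (intro nonneg_conj_invertible nonneg_add nonneg_plus_invertible) simp_all
  then show "eventually (\<lambda>n. nonneg (?f n)) sequentially" by (intro always_eventually) blast
qed simp

text \<open>\<open>b\<close> is selfadjoint and equals \<open>b * a * b\<close>, a conjugate of
  \<open>a\<close>.\<close>

lemma nonneg_inverse:
  assumes "nonneg a" "a * b = 1" "b * a = 1"
  shows "nonneg b"
proof -
  have "star b = b" using star_inverse assms nonneg_star by metis
  from nonneg_conj[OF assms(1) this] show ?thesis using assms by simp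
qed

text \<open>\<open>s - 1\<close> is the product of \<open>s * s - 1\<close> and the inverse of
  \<open>s + 1\<close>, which commute and are both nonnegative.\<close>

lemma sqrt_ge_one:
  assumes "nonneg (x - 1)"
  obtains s where "nonneg (s - 1)" "s * s = x"
proof -
  have "nonneg x" using nonneg_add[OF assms nonneg_one] by simp
  then obtain s where s: "nonneg s" "s * s = x" using nonneg_sqrt by metis
  have p1: "nonneg (s + 1)" by (intro nonneg_add s nonneg_one)
  obtain c where c: "(s + 1) * c = 1" "c * (s + 1) = 1"
    using nonneg_plus_invertible[OF s(1), of 1] by (auto simp: invertible_elem_def)
  have "c * s = 1 - c" "s * c = 1 - c" using c by (simp_all add: algebra_simps eq_diff_eq)
  then have cs: "c * s = s * c" by simp
  have "nonneg ((s * s - 1) * c)"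
  proof (rule nonneg_mult)
    show "nonneg (s * s - 1)" using s assms by simp
    show "nonneg c" using p1 c by (rule nonneg_inverse)
    have "s * s * c = c * (s * s)" using cs by (metis mult.assoc)
    then show "(s * s - 1) * c = c * (s * s - 1)" by (simp add: algebra_simps)
  qed
  moreover have "(s * s - 1) = (s - 1) * (s + 1)" by (simp add: algebra_simps)
  ultimately have "nonneg (s - 1)" using c(1) by (simp add: mult.assoc)
  then show ?thesis using s(2) that by blast
qed

text \<open>Conjugations by \<open>y\<close> and by its inverse \<open>b\<close> preserve
  nonnegativity and undo each other, so the order bound on \<open>y * x * y\<close> can be moved to
  \<open>x\<close>.\<close>

lemma norm_conj_le_iff:
  assumes x: "nonneg x" and y: "star y = y" "y * b = 1" "b * y = 1" and c: "c \<ge> 0"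
  shows "norm (y * x * y) \<le> c \<longleftrightarrow> nonneg (c *\<^sub>R (b * b) - x)"
proof -
  have b: "star b = b" using star_inverse y by metis
  have "y * (b * b) * y = 1" "b * (y * x * y) * b = x"
    using y(2,3) by (metis mult.assoc mult.right_neutral mult_1)+
  then have 1: "y * (c *\<^sub>R (b * b) - x) * y = of_real c - y * x * y"
    and 2: "b * (of_real c - y * x * y) * b = c *\<^sub>R (b * b) - x"
    by (simp_all add: algebra_simps) (simp_all add: of_real_def)
  have "norm (y * x * y) \<le> c \<longleftrightarrow> nonneg (of_real c - y * x * y)"
    by (intro norm_nonneg_le_iff nonneg_conj x y c)
  also have "\<dots> \<longleftrightarrow> nonneg (c *\<^sub>R (b * b) - x)"
    using nonneg_conj[OF _ y(1), of "c *\<^sub>R (b * b) - x"] nonneg_conj[OF _ b, of "of_real c - y * x * y"]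
    unfolding 1 2 by blast
  finally show ?thesis .
qed

section \<open>The positive definite cone\<close>

lemma minus_scaleC_one:
  "x - c *\<^sub>C 1 = (x - of_real (Re c)) + (- Im c) *\<^sub>R (imag_unit :: 'a::unital_cstar_algebra)"
  by (simp add: scaleC_eq of_real_def)

text \<open>The only passage between the spectral definition and the norm condition. Forwards,
  \<open>x\<close> is joined to a large translate of itself, and the path stays invertible because
  negative numbers are not in the spectrum. Backwards, nonreal and negative spectral values are
  excluded separately.\<close>

lemma pos_def_cone_iff:
  "x \<in> pos_def_cone \<longleftrightarrow> nonneg x \<and> invertible_elem (x :: 'a::unital_cstar_algebra)"
proof
  assume "x \<in> pos_def_cone"
  then have sx: "star x = x" and spec: "cstar_spectrum x \<subseteq> complex_of_real ` {0..}"
    and ix: "invertible_elem x"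
    by (auto simp: pos_def_cone_def cstar_positive_def)
  \<comment> \<open>\<open>K\<close> exceeds \<open>norm x\<close>, so \<open>x + K\<close> is
    nonnegative, and it is visibly positive.\<close>
  define K where "K = norm x + 1"
  define p where "p = (\<lambda>t. x + of_real ((1 - t) * K))"
  have "nonneg (p 1)"
  proof (rule nonneg_path)
    show "continuous_on {0..1} p" unfolding p_def by (intro continuous_intros)
    show "star (p t) = p t" for t by (simp only: p_def star_add star_of_real sx)
    show "invertible_elem (p t)" if t: "t \<in> {0..<1}" for t
    proof -
      have "(1 - t) * K > 0" using t unfolding K_def
        by (intro mult_pos_pos) (auto intro: add_nonneg_pos)
      then have "complex_of_real (- ((1 - t) * K)) \<notin> complex_of_real ` {0..}"
        unfolding image_iff of_real_eq_iff by (auto simp del: of_real_mult)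
      then have "complex_of_real (- ((1 - t) * K)) \<notin> cstar_spectrum x" using spec by blast
      then show ?thesis
        by (simp add: cstar_spectrum_def minus_scaleC_one p_def)
    qed
    show "nonneg (p 0)" unfolding p_def using nonneg_of_real_plus[OF sx, of K]
      by (simp add: K_def add.commute)
  qed
  then show "nonneg x \<and> invertible_elem x" using ix by (simp add: p_def)
next
  assume x: "nonneg x \<and> invertible_elem x"
  have "c \<in> complex_of_real ` {0..}" if "c \<in> cstar_spectrum x" for c
  proof -
    have ni: "\<not> invertible_elem ((x - of_real (Re c)) + (- Im c) *\<^sub>R imag_unit)"
      using that by (simp add: cstar_spectrum_def minus_scaleC_one)
    have im: "Im c = 0"
      using ni invertible_plus_imag[of "x - of_real (Re c)" "- Im c"] x
      by (auto simp: star_diff nonneg_star)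
    have "Re c \<ge> 0"
      using ni nonneg_plus_invertible[of x "- Re c"] x im by fastforce
    then show ?thesis using im by (intro image_eqI[of _ _ "Re c"]) (auto simp: complex_eq_iff)
  qed
  then show "x \<in> pos_def_cone"
    using x by (auto simp: pos_def_cone_def cstar_positive_def nonneg_star)
qed

lemma pos_def_cone_nonneg: "x \<in> pos_def_cone \<Longrightarrow> nonneg x"
  by (simp add: pos_def_cone_iff)

lemma pos_def_cone_iff_bounded_below:
  "x \<in> pos_def_cone \<longleftrightarrow> (\<exists>d>0. nonneg (x - of_real d))"
proof
  assume "x \<in> pos_def_cone"
  then show "\<exists>d>0. nonneg (x - of_real d)"
    using nonneg_invertible_bounded_below unfolding pos_def_cone_iff invertible_elem_def by metis
next
  assume "\<exists>d>0. nonneg (x - of_real d)"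
  then obtain d where d: "d > 0" "nonneg (x - of_real d)" by blast
  then have "nonneg (of_real d :: 'a)" by (simp add: nonneg_of_real)
  then show "x \<in> pos_def_cone"
    using nonneg_add[OF d(2)] nonneg_plus_invertible[OF d(2,1)] by (fastforce simp: pos_def_cone_iff)
qed

lemma pos_def_cone_one: "1 \<in> pos_def_cone"
  unfolding pos_def_cone_iff_bounded_below by (intro exI[of _ 1]) (simp add: nonneg_zero)

lemma pos_def_cone_scaleR: "x \<in> pos_def_cone \<Longrightarrow> r > 0 \<Longrightarrow> r *\<^sub>R x \<in> pos_def_cone"
  by (simp add: pos_def_cone_iff nonneg_scaleR invertible_elem_scaleR)

lemma pos_def_cone_inverse:
  assumes "x \<in> pos_def_cone"
  obtains b where "b \<in> pos_def_cone" "x * b = 1" "b * x = 1"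
proof -
  obtain b where b: "x * b = 1" "b * x = 1"
    using assms by (auto simp: pos_def_cone_iff invertible_elem_def)
  have "b \<in> pos_def_cone"
    using assms b nonneg_inverse[of x b] unfolding pos_def_cone_iff invertible_elem_def by blast
  then show ?thesis using b that by blast
qed

lemma pos_def_cone_square: "x \<in> pos_def_cone \<Longrightarrow> x * x \<in> pos_def_cone"
  by (simp add: pos_def_cone_iff nonneg_square nonneg_star invertible_elem_mult)

lemma pos_def_cone_sqrt:
  assumes "x \<in> pos_def_cone"
  obtains s where "s \<in> pos_def_cone" "s * s = x"
proof -
  obtain s where s: "nonneg s" "s * s = x"
    using nonneg_sqrt pos_def_cone_nonneg[OF assms] by metis
  then have "invertible_elem s"
    using invertible_elem_commuting_factor[of s s] assms by (simp add: pos_def_cone_iff)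
  then show ?thesis using s that by (simp add: pos_def_cone_iff)
qed

lemma pos_def_cone_near_one:
  fixes z :: "'a::unital_cstar_algebra"
  assumes "star z = z" "norm (z - 1) \<le> 1/2"
  shows "z \<in> pos_def_cone" "nonneg (z - of_real (1/2))"
proof -
  have "nonneg (of_real (1/2) + (z - 1))"
    using assms by (intro nonneg_of_real_plus) (simp_all add: star_diff)
  moreover have "of_real (1/2) + (z - 1) = z - of_real (1/2)"
    using of_real_diff[of 1 "1/2", where 'a='a] by (simp add: algebra_simps)
  ultimately show n: "nonneg (z - of_real (1/2))" by simp
  then show "z \<in> pos_def_cone" unfolding pos_def_cone_iff_bounded_below by (intro exI[of _ "1/2"]) simp
qed

text \<open>\<open>d - 1\<close> is annihilated by \<open>d * d + d + 1\<close>, which is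
  invertible. This fact will pin down the image of the unit.\<close>

lemma nonneg_cube_eq_one:
  assumes "nonneg d" "d * d * d = 1"
  shows "d = 1"
proof -
  have "nonneg (d * d + d)" using assms by (intro nonneg_add nonneg_square) (simp_all add: nonneg_star)
  then have "invertible_elem (d * d + d + of_real 1)" by (rule nonneg_plus_invertible) simp
  then obtain c where c: "(d * d + d + 1) * c = 1" by (auto simp: invertible_elem_def)
  have "(d - 1) * (d * d + d + 1) = 0" using assms(2) by (simp add: algebra_simps)
  then have "(d - 1) * ((d * d + d + 1) * c) = 0" by (simp add: mult.assoc[symmetric])
  then show ?thesis using c by simp
qed

section \<open>Positively homogeneous maps of the cone and their derivative\<close>

text \<open>These axioms are shared by a norm preserver and its inverse, so every estimate derived
  from them can be used in both directions.\<close>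

locale cone_map =
  fixes \<phi> :: "'a::unital_cstar_algebra \<Rightarrow> 'b::unital_cstar_algebra"
  assumes closed: "x \<in> pos_def_cone \<Longrightarrow> \<phi> x \<in> pos_def_cone"
    and mono: "x \<in> pos_def_cone \<Longrightarrow> y \<in> pos_def_cone \<Longrightarrow> nonneg (y - x) \<Longrightarrow> nonneg (\<phi> y - \<phi> x)"
    and homogeneous: "x \<in> pos_def_cone \<Longrightarrow> r > 0 \<Longrightarrow> \<phi> (r *\<^sub>R x) = r *\<^sub>R \<phi> x"
    and unital: "\<phi> 1 = 1"
    and fourth_power: "x \<in> pos_def_cone \<Longrightarrow> \<phi> (x ^ 4) = \<phi> x ^ 4"
begin

lemma star_image: "x \<in> pos_def_cone \<Longrightarrow> star (\<phi> x) = \<phi> x"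
  using closed by (simp add: pos_def_cone_nonneg nonneg_star)

lemma of_real_image: "r > 0 \<Longrightarrow> \<phi> (of_real r) = of_real r"
  using homogeneous[OF pos_def_cone_one] by (simp add: of_real_def unital)

lemma upper_bound:
  assumes "x \<in> pos_def_cone" "r > 0" "nonneg (of_real r - x)"
  shows "nonneg (of_real r - \<phi> x)"
  using mono[OF assms(1) _ assms(3)] pos_def_cone_scaleR[OF pos_def_cone_one assms(2)] assms(2)
  by (simp add: of_real_image flip: of_real_def)

lemma lower_bound:
  assumes "x \<in> pos_def_cone" "r > 0" "nonneg (x - of_real r)"
  shows "nonneg (\<phi> x - of_real r)"
  using mono[OF _ assms(1,3)] pos_def_cone_scaleR[OF pos_def_cone_one assms(2)] assms(2)
  by (simp add: of_real_image flip: of_real_def)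

text \<open>\<open>z\<close> lies between the scalars \<open>1 - m\<close> and \<open>1 + m\<close>
  for \<open>m = norm (z - 1)\<close>, and positive scalars are fixed; \<open>m \<le> 1/2\<close>
  keeps the lower one positive.\<close>

lemma norm_image_minus_one:
  assumes "star z = z" "norm (z - 1) \<le> 1/2"
  shows "norm (\<phi> z - 1) \<le> norm (z - 1)"
proof -
  let ?m = "norm (z - 1)"
  have z: "z \<in> pos_def_cone" using assms by (rule pos_def_cone_near_one)
  have "nonneg (of_real ?m - (z - 1))" "nonneg (of_real ?m + (z - 1))"
    using assms by (intro nonneg_of_real_minus nonneg_of_real_plus; simp add: star_diff)+
  then have "nonneg (of_real (1 + ?m) - z)" "nonneg (z - of_real (1 - ?m))"
    by (simp_all add: algebra_simps)
  moreover have "1 + ?m > 0" "1 - ?m > 0" using assms(2) norm_ge_zero[of "z - 1"] by linarith+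
  ultimately have "nonneg (of_real (1 + ?m) - \<phi> z)" "nonneg (\<phi> z - of_real (1 - ?m))"
    using upper_bound lower_bound z by blast+
  then show ?thesis by (intro norm_le_of_nonneg) (simp_all add: algebra_simps)
qed

text \<open>Order and homogeneity suffice. With \<open>d = norm (y - z)\<close>, the bound
  \<open>z \<ge> 1/2\<close> gives \<open>y \<le> z + d \<le> (1 + 2 * d) z\<close>; applying
  \<open>\<phi>\<close> and using \<open>\<phi> z \<le> 3/2\<close> leaves an excess of at most
  \<open>3 * d\<close>.\<close>

lemma lipschitz_near_one:
  assumes "star y = y" "star z = z" "norm (y - 1) \<le> 1/2" "norm (z - 1) \<le> 1/2"
  shows "norm (\<phi> y - \<phi> z) \<le> 3 * norm (y - z)"
proof -
  have one_sided: "nonneg (of_real (3 * norm (y - z)) - (\<phi> y - \<phi> z))"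
    if "star y = y" "star z = z" "norm (y - 1) \<le> 1/2" "norm (z - 1) \<le> 1/2" for y z
  proof -
    define d where "d = norm (y - z)"
    have d: "d \<ge> 0" by (simp add: d_def)
    have y: "y \<in> pos_def_cone" and z: "z \<in> pos_def_cone" and z2: "nonneg (z - of_real (1/2))"
      using that pos_def_cone_near_one by blast+
    have "nonneg (of_real d - (y - z))"
      using that by (intro nonneg_of_real_minus) (simp_all add: star_diff d_def)
    moreover have "nonneg ((2 * d) *\<^sub>R (z - of_real (1/2)))" using z2 d by (intro nonneg_scaleR) simp_all
    moreover have "of_real d - (y - z) + (2 * d) *\<^sub>R (z - of_real (1/2)) = (1 + 2 * d) *\<^sub>R z - y"
      by (simp add: of_real_def algebra_simps)
    ultimately have "nonneg ((1 + 2 * d) *\<^sub>R z - y)" using nonneg_add by metis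
    then have "nonneg (\<phi> ((1 + 2 * d) *\<^sub>R z) - \<phi> y)"
      using d by (intro mono y pos_def_cone_scaleR z) simp_all
    then have 1: "nonneg ((1 + 2 * d) *\<^sub>R \<phi> z - \<phi> y)" using d by (simp add: homogeneous z)
    have "nonneg (of_real (1/2) - (z - 1))"
      using that by (intro nonneg_of_real_minus) (simp_all add: star_diff)
    moreover have "of_real (1/2) - (z - 1) = of_real (3/2) - z"
      using of_real_add[of "1/2" 1, where 'a='a] by simp
    ultimately have "nonneg (of_real (3/2) - z)" by simp
    then have "nonneg ((2 * d) *\<^sub>R (of_real (3/2) - \<phi> z))"
      using d upper_bound[OF z, of "3/2"] by (intro nonneg_scaleR) simp_all
    from nonneg_add[OF 1 this] show ?thesis
      by (simp add: of_real_def algebra_simps d_def)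
  qed
  have "nonneg (of_real (3 * norm (y - z)) - (\<phi> y - \<phi> z))" using one_sided[of y z] assms by blast
  moreover have "nonneg (of_real (3 * norm (y - z)) + (\<phi> y - \<phi> z))"
    using one_sided[of z y] assms by (simp add: norm_minus_commute algebra_simps)
  ultimately show ?thesis by (rule norm_le_of_nonneg)
qed

end

section \<open>Existence and properties of the derivative at the unit\<close>

lemma fourth_power_expansion:
  fixes x :: "'a::real_normed_algebra_1"
  assumes "norm x \<le> 1"
  shows "norm ((1 + x) ^ 4 - 1 - 4 *\<^sub>R x) \<le> 11 * (norm x)\<^sup>2"
proof -
  have s4: "4 *\<^sub>R y = y + y + y + y" for y :: 'a
    using scaleR_left_distrib[of 2 2 y] by (simp add: scaleR_2 add.assoc)
  have s6: "6 *\<^sub>R y = y + y + y + y + y + y" for y :: 'a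
    using scaleR_left_distrib[of 4 2 y] by (simp add: s4 scaleR_2 add.assoc)
  have "(1 + x) ^ 4 = 1 + 4 *\<^sub>R x + 6 *\<^sub>R (x ^ 2) + 4 *\<^sub>R (x ^ 3) + x ^ 4"
    by (simp add: s4 s6 power4_eq_xxxx power2_eq_square power3_eq_cube algebra_simps)
  then have "norm ((1 + x) ^ 4 - 1 - 4 *\<^sub>R x) = norm (6 *\<^sub>R (x ^ 2) + 4 *\<^sub>R (x ^ 3) + x ^ 4)"
    by simp
  also have "\<dots> \<le> 6 * norm (x ^ 2) + 4 * norm (x ^ 3) + norm (x ^ 4)"
    by (intro norm_triangle_le add_mono) simp_all
  also have "\<dots> \<le> 6 * norm x ^ 2 + 4 * norm x ^ 3 + norm x ^ 4"
    by (intro add_mono mult_left_mono norm_power_ineq) simp_all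
  \<comment> \<open>Higher powers are absorbed since \<open>norm x \<le> 1\<close>, whence 11 = 6 +
    4 + 1.\<close>
  also have "\<dots> \<le> 6 * norm x ^ 2 + 4 * norm x ^ 2 + norm x ^ 2"
    using assms by (intro add_mono mult_left_mono power_decreasing) simp_all
  finally show ?thesis by simp
qed

text \<open>A difference quotient at the unit along the step sizes \<open>4^-n\<close> only, because
  the fourth power rule links a step size with four times itself.\<close>

definition cone_quotient :: "('a::unital_cstar_algebra \<Rightarrow> 'b::unital_cstar_algebra) \<Rightarrow> 'a \<Rightarrow> nat \<Rightarrow> 'b" where
  "cone_quotient \<phi> h n = 4 ^ n *\<^sub>R (\<phi> (1 + (1/4) ^ n *\<^sub>R h) - 1)"

definition cone_deriv :: "('a::unital_cstar_algebra \<Rightarrow> 'b::unital_cstar_algebra) \<Rightarrow> 'a \<Rightarrow> 'b" where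
  "cone_deriv \<phi> h = lim (cone_quotient \<phi> h)"

lemma cone_quotient_eq: "\<phi> (1 + (1/4) ^ n *\<^sub>R h) = 1 + (1/4) ^ n *\<^sub>R cone_quotient \<phi> h n"
  by (simp add: cone_quotient_def flip: power_mult_distrib)

lemma quarter_power_tendsto_zero: "(\<lambda>n. (1/4::real) ^ n * m) \<longlonglongrightarrow> 0"
  by (intro tendsto_mult_left_zero LIMSEQ_power_zero) simp

lemma eventually_quarter_power_le:
  "e > 0 \<Longrightarrow> eventually (\<lambda>n. (1/4::real) ^ n * m \<le> e) sequentially"
  using order_tendstoD(2)[OF quarter_power_tendsto_zero[of m], of e]
  by (auto elim: eventually_mono)

lemma null_by_quarter_powers:
  fixes f :: "nat \<Rightarrow> 'a::real_normed_vector"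
  assumes "eventually (\<lambda>n. norm (f n) \<le> (1/4) ^ n * m) sequentially"
  shows "f \<longlonglongrightarrow> 0"
  by (rule tendsto_norm_zero_cancel,
      rule tendsto_sandwich[OF _ assms tendsto_const quarter_power_tendsto_zero]) simp

context cone_map
begin

text \<open>\<open>1 + 4 y\<close> is compared with \<open>(1 + y)^4\<close>, whose image is
  \<open>(1 + x)^4\<close>, and this with \<open>1 + 4 x\<close>, where
  \<open>x = \<phi> (1 + y) - 1\<close>. The first error passes through the Lipschitz constant 3, so
  44 = 3 * 11 + 11. The bound 1/16 keeps \<open>1 + 4 y\<close> and \<open>(1 + y)^4\<close> within
  1/2 of the unit.\<close>

lemma fourth_step:
  assumes "star y = y" "norm y \<le> 1/16"
  shows "norm (\<phi> (1 + 4 *\<^sub>R y) - 1 - 4 *\<^sub>R (\<phi> (1 + y) - 1)) \<le> 44 * (norm y)\<^sup>2"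
proof -
  have ysq: "(norm y)\<^sup>2 \<le> 1/256" using power_mono[OF assms(2), of 2] by (simp add: power_divide)
  have y1: "1 + y \<in> pos_def_cone"
    using assms by (intro pos_def_cone_near_one) (simp_all add: star_add)
  define x where "x = \<phi> (1 + y) - 1"
  have nx: "norm x \<le> norm y"
    using norm_image_minus_one[of "1 + y"] assms by (simp add: x_def star_add)
  let ?e = "(1 + y) ^ 4 - 1 - 4 *\<^sub>R y"
  have e: "norm ?e \<le> 11 * (norm y)\<^sup>2" using assms by (intro fourth_power_expansion) simp
  have "norm (\<phi> (1 + 4 *\<^sub>R y) - \<phi> ((1 + y) ^ 4)) \<le> 3 * norm (1 + 4 *\<^sub>R y - (1 + y) ^ 4)"
  proof (rule lipschitz_near_one)
    show "norm ((1 + y) ^ 4 - 1) \<le> 1/2"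
      using norm_triangle_ineq[of ?e "4 *\<^sub>R y"] e ysq assms(2) by simp
  qed (use assms in \<open>simp_all add: star_add star_scaleR star_power\<close>)
  also have "norm (1 + 4 *\<^sub>R y - (1 + y) ^ 4) = norm ?e"
    by (subst norm_minus_commute) (simp add: algebra_simps)
  finally have 1: "norm (\<phi> (1 + 4 *\<^sub>R y) - \<phi> ((1 + y) ^ 4)) \<le> 33 * (norm y)\<^sup>2" using e by simp
  have "norm ((1 + x) ^ 4 - 1 - 4 *\<^sub>R x) \<le> 11 * (norm x)\<^sup>2"
    using nx assms by (intro fourth_power_expansion) simp
  also have "\<dots> \<le> 11 * (norm y)\<^sup>2" using nx by (simp add: power_mono)
  finally have 2: "norm ((1 + x) ^ 4 - 1 - 4 *\<^sub>R x) \<le> 11 * (norm y)\<^sup>2" .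
  have "\<phi> ((1 + y) ^ 4) = (1 + x) ^ 4" using fourth_power[OF y1] by (simp add: x_def)
  then have eq: "\<phi> (1 + 4 *\<^sub>R y) - 1 - 4 *\<^sub>R x
      = (\<phi> (1 + 4 *\<^sub>R y) - \<phi> ((1 + y) ^ 4)) + ((1 + x) ^ 4 - 1 - 4 *\<^sub>R x)" by simp
  have "norm (\<phi> (1 + 4 *\<^sub>R y) - 1 - 4 *\<^sub>R x) \<le> 44 * (norm y)\<^sup>2"
    unfolding eq
    using norm_triangle_ineq[of "\<phi> (1 + 4 *\<^sub>R y) - \<phi> ((1 + y) ^ 4)" "(1 + x) ^ 4 - 1 - 4 *\<^sub>R x"] 1 2
    by linarith
  then show ?thesis by (simp add: x_def)
qed

lemma quotient_step:
  assumes h: "star h = h" and n: "(1/4) ^ n * norm h \<le> 1/4"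
  shows "norm (cone_quotient \<phi> h (Suc n) - cone_quotient \<phi> h n) \<le> 3 * (1/4) ^ n * (norm h)\<^sup>2"
proof -
  define t :: real where "t = (1/4) ^ n"
  have t: "t > 0" "4 ^ n * t = 1" by (simp_all add: t_def flip: power_mult_distrib)
  define y where "y = (t / 4) *\<^sub>R h"
  have "cone_quotient \<phi> h n - cone_quotient \<phi> h (Suc n)
      = 4 ^ n *\<^sub>R (\<phi> (1 + 4 *\<^sub>R y) - 1 - 4 *\<^sub>R (\<phi> (1 + y) - 1))"
    by (simp add: cone_quotient_def y_def t_def algebra_simps)
  moreover have "norm (\<phi> (1 + 4 *\<^sub>R y) - 1 - 4 *\<^sub>R (\<phi> (1 + y) - 1)) \<le> 44 * (norm y)\<^sup>2"
    using h n t by (intro fourth_step) (simp_all add: y_def star_scaleR t_def mult_ac)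
  ultimately have "norm (cone_quotient \<phi> h (Suc n) - cone_quotient \<phi> h n) \<le> 4 ^ n * (44 * (norm y)\<^sup>2)"
    by (subst norm_minus_commute) simp
  also have "\<dots> = (4 ^ n * t) * (44/16 * t * (norm h)\<^sup>2)"
    using t(1) by (simp add: y_def power2_eq_square)
  \<comment> \<open>44/16 is rounded up to 3, because
    \<open>3 * 4^-n = 4 * (4^-n - 4^-(n+1))\<close> makes the next estimate telescope
    exactly.\<close>
  also have "\<dots> \<le> 3 * t * (norm h)\<^sup>2" using t by (simp add: mult_right_mono)
  finally show ?thesis by (simp add: t_def)
qed

lemma quotient_diff:
  assumes h: "star h = h" and n: "(1/4) ^ n * norm h \<le> 1/4"
  shows "norm (cone_quotient \<phi> h (n + k) - cone_quotient \<phi> h n)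
    \<le> 4 * (norm h)\<^sup>2 * ((1/4) ^ n - (1/4) ^ (n + k))"
proof (induction k)
  case (Suc k)
  have "(1/4) ^ (n + k) * norm h \<le> (1/4) ^ n * norm h"
    by (intro mult_right_mono power_decreasing) simp_all
  then have "norm (cone_quotient \<phi> h (Suc (n + k)) - cone_quotient \<phi> h (n + k))
      \<le> 3 * (1/4) ^ (n + k) * (norm h)\<^sup>2"
    using n by (intro quotient_step h) linarith
  then show ?case
    using Suc norm_triangle_ineq[of "cone_quotient \<phi> h (Suc (n + k)) - cone_quotient \<phi> h (n + k)"
        "cone_quotient \<phi> h (n + k) - cone_quotient \<phi> h n"]
    by (simp add: algebra_simps)
qed simp

lemma deriv_tendsto:
  assumes h: "star h = h"
  shows "cone_quotient \<phi> h \<longlonglongrightarrow> cone_deriv \<phi> h"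
proof -
  let ?q = "cone_quotient \<phi> h"
  have "Cauchy ?q"
  proof (rule metric_CauchyI)
    fix e :: real assume e: "e > 0"
    have "eventually (\<lambda>n. (1/4) ^ n * norm h \<le> 1/4 \<and> (1/4) ^ n * (4 * (norm h)\<^sup>2) \<le> e/2) sequentially"
      using e by (intro eventually_conj eventually_quarter_power_le) simp_all
    then obtain N where N: "\<And>n. n \<ge> N \<Longrightarrow> (1/4) ^ n * norm h \<le> 1/4"
      "\<And>n. n \<ge> N \<Longrightarrow> (1/4) ^ n * (4 * (norm h)\<^sup>2) \<le> e/2"
      unfolding eventually_sequentially by blast
    have ord: "dist (?q m) (?q n) < e" if "n \<ge> N" "m \<ge> n" for m n
    proof -
      have "norm (?q (n + (m - n)) - ?q n) \<le> 4 * (norm h)\<^sup>2 * ((1/4) ^ n - (1/4) ^ (n + (m - n)))"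
        using that by (intro quotient_diff h N)
      also have "\<dots> \<le> 4 * (norm h)\<^sup>2 * (1/4) ^ n" by (intro mult_left_mono) simp_all
      also have "\<dots> = (1/4) ^ n * (4 * (norm h)\<^sup>2)" by simp
      also have "\<dots> \<le> e/2" using that by (intro N)
      also have "\<dots> < e" using e by simp
      finally show ?thesis using that by (simp add: dist_norm)
    qed
    have "dist (?q m) (?q n) < e" if "n \<ge> N" "m \<ge> N" for m n
      using ord[of n m] ord[of m n] that by (metis dist_commute le_cases)
    then show "\<exists>M. \<forall>m\<ge>M. \<forall>n\<ge>M. dist (?q m) (?q n) < e" by blast
  qed
  then show ?thesis unfolding cone_deriv_def
    using Cauchy_convergent convergent_LIMSEQ_iff by blast
qed

text \<open>This is \<open>quotient_diff\<close> with \<open>k\<close> tending to infinity. The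
  constant is uniform in \<open>h\<close>, which matters later when \<open>h\<close> itself varies
  with \<open>n\<close>.\<close>

lemma deriv_error:
  assumes h: "star h = h" and n: "(1/4) ^ n * norm h \<le> 1/4"
  shows "norm (\<phi> (1 + (1/4) ^ n *\<^sub>R h) - (1 + (1/4) ^ n *\<^sub>R cone_deriv \<phi> h))
    \<le> 4 * ((1/4) ^ n * norm h)\<^sup>2"
proof -
  let ?q = "cone_quotient \<phi> h" and ?f = "cone_deriv \<phi> h" and ?t = "(1/4::real) ^ n"
  have "(\<lambda>k. norm (?q (k + n) - ?q n)) \<longlonglongrightarrow> norm (?f - ?q n)"
    by (intro tendsto_intros LIMSEQ_ignore_initial_segment deriv_tendsto h)
  moreover have "norm (?q (k + n) - ?q n) \<le> 4 * (norm h)\<^sup>2 * ?t" for k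
  proof -
    have "4 * (norm h)\<^sup>2 * (?t - (1/4) ^ (n + k)) \<le> 4 * (norm h)\<^sup>2 * ?t"
      by (intro mult_left_mono) simp_all
    then show ?thesis using quotient_diff[OF h n, of k] by (simp add: add.commute)
  qed
  ultimately have le: "norm (?f - ?q n) \<le> 4 * (norm h)\<^sup>2 * ?t"
    by (intro LIMSEQ_le_const2) blast+
  have "norm (\<phi> (1 + ?t *\<^sub>R h) - (1 + ?t *\<^sub>R ?f)) = norm (?t *\<^sub>R (?q n - ?f))"
    by (simp add: cone_quotient_eq[of \<phi> n h] scaleR_diff_right)
  also have "\<dots> = ?t * norm (?f - ?q n)" by (simp add: norm_minus_commute)
  also have "\<dots> \<le> ?t * (4 * (norm h)\<^sup>2 * ?t)" using le by (intro mult_left_mono) simp_all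
  finally show ?thesis by (simp add: power2_eq_square mult_ac)
qed

lemma near_one:
  assumes h: "star h = h" and n: "(1/4) ^ n * norm h \<le> 1/2"
  shows "star (1 + (1/4) ^ n *\<^sub>R h) = 1 + (1/4) ^ n *\<^sub>R h"
    "norm (1 + (1/4) ^ n *\<^sub>R h - 1) \<le> 1/2"
    "1 + (1/4) ^ n *\<^sub>R h \<in> pos_def_cone"
proof -
  show 1: "star (1 + (1/4) ^ n *\<^sub>R h) = 1 + (1/4) ^ n *\<^sub>R h" using h by (simp add: star_add star_scaleR)
  show 2: "norm (1 + (1/4) ^ n *\<^sub>R h - 1) \<le> 1/2" using n by simp
  show "1 + (1/4) ^ n *\<^sub>R h \<in> pos_def_cone" using 1 2 by (rule pos_def_cone_near_one)
qed

lemma deriv_star: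
  assumes h: "star h = h"
  shows "star (cone_deriv \<phi> h) = cone_deriv \<phi> h"
proof -
  have "eventually (\<lambda>n. star (cone_quotient \<phi> h n) = cone_quotient \<phi> h n) sequentially"
    using eventually_quarter_power_le[of "1/2" "norm h"]
    by (rule eventually_mono)
      (simp_all add: cone_quotient_def star_scaleR star_diff star_image near_one(3)[OF h])
  then have "(\<lambda>n. star (cone_quotient \<phi> h n)) \<longlonglongrightarrow> cone_deriv \<phi> h"
    using Lim_transform_eventually[OF deriv_tendsto[OF h]] by (simp add: eq_commute)
  then show ?thesis using tendsto_star[OF deriv_tendsto[OF h]] LIMSEQ_unique by blast
qed

lemma deriv_mono:
  assumes h: "star h = h" and k: "star k = k" and hk: "nonneg (k - h)"
  shows "nonneg (cone_deriv \<phi> k - cone_deriv \<phi> h)"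
proof (rule nonneg_limit)
  let ?q = "cone_quotient \<phi>"
  show "(\<lambda>n. ?q k n - ?q h n) \<longlonglongrightarrow> cone_deriv \<phi> k - cone_deriv \<phi> h"
    by (intro tendsto_diff deriv_tendsto h k)
  have "eventually (\<lambda>n. (1/4) ^ n * norm h \<le> 1/2 \<and> (1/4) ^ n * norm k \<le> 1/2) sequentially"
    by (intro eventually_conj eventually_quarter_power_le) simp_all
  then show "eventually (\<lambda>n. nonneg (?q k n - ?q h n)) sequentially"
  proof eventually_elim
    case (elim n)
    have "nonneg ((1/4::real) ^ n *\<^sub>R (k - h))" using hk by (rule nonneg_scaleR) simp
    then have "nonneg (\<phi> (1 + (1/4) ^ n *\<^sub>R k) - \<phi> (1 + (1/4) ^ n *\<^sub>R h))"
      using elim by (intro mono near_one h k) (simp_all add: scaleR_diff_right)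
    then have "nonneg ((4::real) ^ n *\<^sub>R (\<phi> (1 + (1/4) ^ n *\<^sub>R k) - \<phi> (1 + (1/4) ^ n *\<^sub>R h)))"
      by (rule nonneg_scaleR) simp
    then show ?case by (simp add: cone_quotient_def algebra_simps)
  qed
qed simp

text \<open>\<open>1 + t (h + c)\<close> and \<open>(1 + t c) (1 + t h)\<close> agree to first order in \<open>t\<close>.\<close>

lemma deriv_translation:
  assumes h: "star h = h"
  shows "cone_deriv \<phi> (h + of_real c) = cone_deriv \<phi> h + of_real c"
proof -
  let ?q = "cone_quotient \<phi>"
  have hc: "star (h + of_real c) = h + of_real c" using h by (simp add: star_add)
  \<comment> \<open>With \<open>t = 4^-n\<close>, \<open>?r n\<close> is the quotient that results
    from \<open>(1 + t * c) *\<^sub>R \<phi> (1 + t *\<^sub>R h)\<close>; the Lipschitz bound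
    compares it with the true one.\<close>
  let ?r = "\<lambda>n. ?q h n + of_real c + ((1/4) ^ n * c) *\<^sub>R ?q h n"
  have "(\<lambda>n. ?q (h + of_real c) n - ?r n) \<longlonglongrightarrow> 0"
  proof (rule null_by_quarter_powers)
    have "eventually (\<lambda>n. (1/4) ^ n * \<bar>c\<bar> \<le> 1/8 \<and> (1/4) ^ n * norm h \<le> 1/8 \<and> (1/4) ^ n * norm (h + of_real c) \<le> 1/2) sequentially"
      by (intro eventually_conj eventually_quarter_power_le) simp_all
    then show "eventually (\<lambda>n. norm (?q (h + of_real c) n - ?r n) \<le> (1/4) ^ n * (3 * \<bar>c\<bar> * norm h)) sequentially"
    proof eventually_elim
      case (elim n)
      define t :: real where "t = (1/4) ^ n"
      have t: "t > 0" "4 ^ n * t = 1" by (simp_all add: t_def flip: power_mult_distrib)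
      have tc: "\<bar>t * c\<bar> \<le> 1/8" using elim t by (simp add: abs_mult t_def)
      let ?y = "1 + t *\<^sub>R (h + of_real c)" and ?z = "(1 + t * c) *\<^sub>R (1 + t *\<^sub>R h)"
      have y: "star ?y = ?y" "norm (?y - 1) \<le> 1/2"
        using near_one[OF hc] elim unfolding t_def by blast+
      have h1: "1 + t *\<^sub>R h \<in> pos_def_cone"
        using near_one[OF h] elim unfolding t_def by simp
      have z1: "star ?z = ?z" using h by (simp add: star_add star_scaleR)
      have "?z - 1 = (t * c) *\<^sub>R 1 + (t + t * c * t) *\<^sub>R h" by (simp add: algebra_simps)
      also have "norm \<dots> \<le> \<bar>t * c\<bar> + \<bar>t + t * c * t\<bar> * norm h"
        by (rule norm_triangle_le) simp
      also have "\<bar>t + t * c * t\<bar> * norm h \<le> (t + \<bar>t * c\<bar> * t) * norm h"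
        using t(1) by (intro mult_right_mono) (auto simp: abs_mult intro: order_trans[OF abs_triangle_ineq])
      also have "(t + \<bar>t * c\<bar> * t) * norm h \<le> (t + 1/8 * t) * norm h"
        using t(1) tc by (intro mult_right_mono add_left_mono) simp_all
      also have "\<bar>t * c\<bar> + (t + 1/8 * t) * norm h \<le> 1/2"
        using elim tc by (simp add: algebra_simps flip: t_def)
      finally have z2: "norm (?z - 1) \<le> 1/2" by simp
      have "?y - ?z = - (t * t * c) *\<^sub>R h" by (simp add: algebra_simps of_real_def)
      then have "norm (\<phi> ?y - \<phi> ?z) \<le> 3 * (t * t * \<bar>c\<bar> * norm h)"
        using lipschitz_near_one[OF y(1) z1 y(2) z2] t(1) by (simp add: abs_mult)
      moreover have "\<phi> ?z = (1 + t * c) *\<^sub>R (1 + t *\<^sub>R ?q h n)"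
        using homogeneous[OF h1, of "1 + t * c"] tc cone_quotient_eq[of \<phi> n h] by (simp add: t_def)
      moreover have "\<phi> ?y = 1 + t *\<^sub>R ?q (h + of_real c) n"
        unfolding t_def by (rule cone_quotient_eq)
      moreover have "1 + t *\<^sub>R ?q (h + of_real c) n - (1 + t * c) *\<^sub>R (1 + t *\<^sub>R ?q h n)
          = t *\<^sub>R (?q (h + of_real c) n - ?r n)"
        by (simp add: algebra_simps of_real_def t_def)
      ultimately have "t * norm (?q (h + of_real c) n - ?r n) \<le> t * (t * (3 * \<bar>c\<bar> * norm h))"
        using t(1) by (simp add: mult_ac)
      then show ?case using t(1) by (simp add: t_def)
    qed
  qed
  moreover have "?r \<longlonglongrightarrow> cone_deriv \<phi> h + of_real c + 0 *\<^sub>R cone_deriv \<phi> h"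
    by (intro tendsto_intros deriv_tendsto h quarter_power_tendsto_zero)
  ultimately have "?q (h + of_real c) \<longlonglongrightarrow> cone_deriv \<phi> h + of_real c"
    using tendsto_add by fastforce
  then show ?thesis using deriv_tendsto[OF hc] LIMSEQ_unique by blast
qed

text \<open>\<open>h \<le> k + norm (h - k)\<close>, so monotonicity and translation bound the
  derivative at \<open>h\<close> from above; exchanging \<open>h\<close> and \<open>k\<close> gives
  the other side.\<close>

lemma deriv_nonexpansive:
  assumes h: "star h = h" and k: "star k = k"
  shows "norm (cone_deriv \<phi> h - cone_deriv \<phi> k) \<le> norm (h - k)"
proof -
  have one_sided: "nonneg (of_real (norm (h - k)) + (cone_deriv \<phi> k - cone_deriv \<phi> h))"
    if h: "star h = h" and k: "star k = k" for h k
  proof -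
    have "nonneg (of_real (norm (h - k)) - (h - k))"
      using h k by (intro nonneg_of_real_minus) (simp_all add: star_diff)
    then have "nonneg (cone_deriv \<phi> (k + of_real (norm (h - k))) - cone_deriv \<phi> h)"
      using h k by (intro deriv_mono) (simp_all add: star_add algebra_simps)
    then show ?thesis by (simp add: deriv_translation k algebra_simps)
  qed
  show ?thesis
    using one_sided[OF h k] one_sided[OF k h]
    by (intro norm_le_of_nonneg) (simp_all add: norm_minus_commute algebra_simps)
qed

end

text \<open>A chain rule: \<open>\<phi> (1 + t h)\<close> differs from \<open>1 + t f h\<close> by
  at most \<open>4 (t norm h)^2\<close>, where \<open>f\<close> is the derivative, and
  \<open>\<psi>\<close> enlarges this by a factor of at most 3, whence the constant 12.\<close>

lemma cone_deriv_inverse: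
  assumes "cone_map \<phi>" "cone_map \<psi>" and inv: "\<And>x. x \<in> pos_def_cone \<Longrightarrow> \<psi> (\<phi> x) = x"
    and h: "star h = h"
  shows "cone_deriv \<psi> (cone_deriv \<phi> h) = h"
proof -
  interpret \<phi>: cone_map \<phi> by fact
  interpret \<psi>: cone_map \<psi> by fact
  let ?f = "cone_deriv \<phi> h"
  have f: "star ?f = ?f" by (rule \<phi>.deriv_star[OF h])
  have "(\<lambda>n. cone_quotient \<psi> ?f n - h) \<longlonglongrightarrow> 0"
  proof (rule null_by_quarter_powers)
    have "eventually (\<lambda>n. (1/4) ^ n * norm h \<le> 1/4 \<and> (1/4) ^ n * norm ?f \<le> 1/2) sequentially"
      by (intro eventually_conj eventually_quarter_power_le) simp_all
    then show "eventually (\<lambda>n. norm (cone_quotient \<psi> ?f n - h) \<le> (1/4) ^ n * (12 * (norm h)\<^sup>2)) sequentially"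
    proof eventually_elim
      case (elim n)
      define t :: real where "t = (1/4) ^ n"
      have t: "t > 0" by (simp add: t_def)
      let ?y = "1 + t *\<^sub>R ?f" and ?z = "1 + t *\<^sub>R h"
      have y: "star ?y = ?y" "norm (?y - 1) \<le> 1/2"
        using \<psi>.near_one[OF f] elim unfolding t_def by blast+
      have z: "star ?z = ?z" "norm (?z - 1) \<le> 1/2" "?z \<in> pos_def_cone"
        using \<phi>.near_one[OF h] elim unfolding t_def by (meson order_trans, simp)+
      have "norm (\<psi> ?y - \<psi> (\<phi> ?z)) \<le> 3 * norm (?y - \<phi> ?z)"
        using \<phi>.norm_image_minus_one[OF z(1,2)] z(2)
        by (intro \<psi>.lipschitz_near_one y \<phi>.star_image z(3)) linarith
      also have "\<dots> \<le> 3 * (4 * (t * norm h)\<^sup>2)"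
        using \<phi>.deriv_error[OF h, of n] elim by (simp add: t_def norm_minus_commute)
      finally have "norm (\<psi> ?y - ?z) \<le> t * (t * (12 * (norm h)\<^sup>2))"
        by (simp add: inv z(3) power2_eq_square mult_ac)
      moreover have "\<psi> ?y - ?z = t *\<^sub>R (cone_quotient \<psi> ?f n - h)"
        using cone_quotient_eq[of \<psi> n ?f] by (simp add: t_def scaleR_diff_right)
      ultimately show ?case using t by (simp add: t_def)
    qed
  qed
  then have "cone_quotient \<psi> ?f \<longlonglongrightarrow> h" by (simp add: LIM_zero_iff)
  then show ?thesis using \<psi>.deriv_tendsto[OF f] LIMSEQ_unique by blast
qed

section \<open>Norm preservers are order isomorphisms\<close>

lemma square_right_inverse: "u * v = 1 \<Longrightarrow> u * u * (v * v) = (1 :: 'a::monoid_mult)"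
  by (metis mult.assoc mult_1)

locale norm_preserver =
  fixes \<phi> :: "'a::unital_cstar_algebra \<Rightarrow> 'b::unital_cstar_algebra"
  assumes onto: "\<phi> ` pos_def_cone = pos_def_cone"
    and norm_preserving: "x \<in> pos_def_cone \<Longrightarrow> y \<in> pos_def_cone \<Longrightarrow>
      norm (\<phi> y * \<phi> x * \<phi> y) = norm (y * x * y)"
begin

lemma image_in_cone: "x \<in> pos_def_cone \<Longrightarrow> \<phi> x \<in> pos_def_cone"
  unfolding onto[symmetric] by (rule imageI)

lemma preimage_in_cone:
  assumes "v \<in> pos_def_cone"
  obtains u where "u \<in> pos_def_cone" "\<phi> u = v"
  using assms unfolding onto[symmetric] by (elim imageE) blast

text \<open>The norm identity pairs \<open>y^-2\<close> with \<open>(\<phi> y)^-2\<close> before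
  these are known to correspond under \<open>\<phi>\<close>. The relation records that
  \<open>w\<close> and \<open>v\<close> bound the same elements from above, tracked through
  \<open>\<phi>\<close>; the factor \<open>c\<close> is kept because it later yields
  homogeneity.\<close>

definition order_related :: "'a \<Rightarrow> 'b \<Rightarrow> bool" where
  "order_related w v \<longleftrightarrow> (\<forall>x\<in>pos_def_cone. \<forall>c\<ge>0. nonneg (c *\<^sub>R w - x) \<longleftrightarrow> nonneg (c *\<^sub>R v - \<phi> x))"

lemma order_relatedD:
  "order_related w v \<Longrightarrow> x \<in> pos_def_cone \<Longrightarrow> nonneg (w - x) \<longleftrightarrow> nonneg (v - \<phi> x)"
  unfolding order_related_def by (metis scaleR_one zero_le_one)

lemma order_related_inverse_square:
  assumes y: "y \<in> pos_def_cone" "y * b = 1" "b * y = 1"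
    and d: "\<phi> y * d = 1" "d * \<phi> y = 1"
  shows "order_related (b * b) (d * d)"
  unfolding order_related_def
proof (intro ballI allI impI)
  fix x :: 'a and c :: real assume x: "x \<in> pos_def_cone" and c: "c \<ge> 0"
  have "nonneg (c *\<^sub>R (b * b) - x) \<longleftrightarrow> norm (y * x * y) \<le> c"
    using norm_conj_le_iff[of x y b c] x y c by (simp add: pos_def_cone_nonneg nonneg_star)
  moreover have "nonneg (c *\<^sub>R (d * d) - \<phi> x) \<longleftrightarrow> norm (\<phi> y * \<phi> x * \<phi> y) \<le> c"
    using norm_conj_le_iff[of "\<phi> x" "\<phi> y" d c] image_in_cone[OF x] image_in_cone[OF y(1)] d c
    by (simp add: pos_def_cone_nonneg nonneg_star)
  ultimately show "nonneg (c *\<^sub>R (b * b) - x) \<longleftrightarrow> nonneg (c *\<^sub>R (d * d) - \<phi> x)"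
    using norm_preserving[OF x y(1)] by simp
qed

lemma order_related_total:
  assumes w: "w \<in> pos_def_cone"
  obtains v where "v \<in> pos_def_cone" "order_related w v"
proof -
  obtain b where b: "b \<in> pos_def_cone" "b * b = w" using pos_def_cone_sqrt[OF w] by metis
  obtain y where y: "y \<in> pos_def_cone" "b * y = 1" "y * b = 1"
    using pos_def_cone_inverse[OF b(1)] by metis
  obtain d where d: "d \<in> pos_def_cone" "\<phi> y * d = 1" "d * \<phi> y = 1"
    using pos_def_cone_inverse[OF image_in_cone[OF y(1)]] by metis
  have "order_related w (d * d)" using order_related_inverse_square y d b(2) by metis
  then show ?thesis using that pos_def_cone_square[OF d(1)] by blast
qed

lemma order_related_surj:
  assumes v: "v \<in> pos_def_cone"
  obtains w where "w \<in> pos_def_cone" "order_related w v"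
proof -
  obtain d where d: "d \<in> pos_def_cone" "d * d = v" using pos_def_cone_sqrt[OF v] by metis
  obtain u where u: "u \<in> pos_def_cone" "d * u = 1" "u * d = 1"
    using pos_def_cone_inverse[OF d(1)] by metis
  obtain y where y: "y \<in> pos_def_cone" "\<phi> y = u" using preimage_in_cone[OF u(1)] by metis
  obtain b where b: "b \<in> pos_def_cone" "y * b = 1" "b * y = 1"
    using pos_def_cone_inverse[OF y(1)] by metis
  have "order_related (b * b) v" using order_related_inverse_square y b u d(2) by metis
  then show ?thesis using that pos_def_cone_square[OF b(1)] by blast
qed

text \<open>A partner \<open>w\<close> of \<open>\<phi> y\<close> satisfies \<open>y \<le> w\<close>
  because \<open>\<phi> y \<le> \<phi> y\<close>; thus \<open>x \<le> w\<close>, which translates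
  back.\<close>

lemma mono_image:
  assumes "x \<in> pos_def_cone" "y \<in> pos_def_cone" "nonneg (y - x)"
  shows "nonneg (\<phi> y - \<phi> x)"
proof -
  obtain w where w: "order_related w (\<phi> y)"
    using order_related_surj image_in_cone[OF assms(2)] by metis
  have "nonneg (w - y)" using order_relatedD[OF w assms(2)] by (simp add: nonneg_zero)
  then have "nonneg (w - x)" using nonneg_add[OF _ assms(3)] by fastforce
  then show ?thesis using order_relatedD[OF w assms(1)] by simp
qed

text \<open>Testing the relation at \<open>w\<close> gives \<open>\<phi> w \<le> v\<close>. By
  surjectivity \<open>v = \<phi> u\<close>; then \<open>u \<le> w\<close>, and monotonicity gives
  \<open>v \<le> \<phi> w\<close>.\<close>

lemma order_related_unique:
  assumes w: "w \<in> pos_def_cone" and v: "v \<in> pos_def_cone" and wv: "order_related w v"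
  shows "v = \<phi> w"
proof -
  have 1: "nonneg (v - \<phi> w)" using order_relatedD[OF wv w] by (simp add: nonneg_zero)
  obtain u where u: "u \<in> pos_def_cone" "\<phi> u = v" using preimage_in_cone[OF v] by metis
  have "nonneg (w - u)" using order_relatedD[OF wv u(1)] u(2) by (simp add: nonneg_zero)
  then have "nonneg (\<phi> w - v)" using mono_image[OF u(1) w] u(2) by simp
  then show ?thesis using nonneg_antisym[OF 1] by simp
qed

lemma order_related_image: "w \<in> pos_def_cone \<Longrightarrow> order_related w (\<phi> w)"
  using order_related_total order_related_unique by metis

lemma image_inverse_square:
  assumes "y \<in> pos_def_cone" "y * b = 1" "b * y = 1" "\<phi> y * d = 1" "d * \<phi> y = 1"
  shows "\<phi> (b * b) = d * d"
proof -
  have "b \<in> pos_def_cone" "d \<in> pos_def_cone"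
    using assms nonneg_inverse[of y b] nonneg_inverse[of "\<phi> y" d] image_in_cone[OF assms(1)]
    unfolding pos_def_cone_iff invertible_elem_def by blast+
  then show ?thesis
    using order_related_unique order_related_inverse_square[OF assms] pos_def_cone_square by metis
qed

lemma image_one: "\<phi> 1 = 1"
proof -
  obtain d where d: "d \<in> pos_def_cone" "\<phi> 1 * d = 1" "d * \<phi> 1 = 1"
    using pos_def_cone_inverse[OF image_in_cone[OF pos_def_cone_one]] by metis
  \<comment> \<open>The unit is its own inverse square, so the inverse square rule applies with
    \<open>y = b = 1\<close>.\<close>
  have e: "\<phi> 1 = d * d" using image_inverse_square[OF pos_def_cone_one _ _ d(2,3), of 1] by simp
  then have "d * d * d = 1" using d(2) by simp
  then have "d = 1" using nonneg_cube_eq_one pos_def_cone_nonneg[OF d(1)] by blast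
  then show ?thesis using e by simp
qed

text \<open>The inverse square rule is used at \<open>x\<close> and then at \<open>b * b\<close>,
  the inverse of \<open>x * x\<close>; the two inversions cancel.\<close>

lemma image_fourth_power:
  assumes x: "x \<in> pos_def_cone"
  shows "\<phi> (x ^ 4) = \<phi> x ^ 4"
proof -
  obtain b where b: "b \<in> pos_def_cone" "x * b = 1" "b * x = 1"
    using pos_def_cone_inverse[OF x] by metis
  obtain d where d: "d \<in> pos_def_cone" "\<phi> x * d = 1" "d * \<phi> x = 1"
    using pos_def_cone_inverse[OF image_in_cone[OF x]] by metis
  have bb: "\<phi> (b * b) = d * d" using image_inverse_square[OF x b(2,3) d(2,3)] .
  have "\<phi> ((x * x) * (x * x)) = (\<phi> x * \<phi> x) * (\<phi> x * \<phi> x)"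
    using b d unfolding bb[symmetric]
    by (intro image_inverse_square[OF pos_def_cone_square[OF b(1)]])
      (simp_all add: bb square_right_inverse)
  then show ?thesis by (simp add: power4_eq_xxxx mult.assoc)
qed

text \<open>Multiplying both partners by \<open>c\<close> only reparametrises the scalar quantified
  in \<open>order_related\<close>.\<close>

lemma image_scaleR:
  assumes w: "w \<in> pos_def_cone" and c: "c > 0"
  shows "\<phi> (c *\<^sub>R w) = c *\<^sub>R \<phi> w"
proof -
  have cw: "c *\<^sub>R w \<in> pos_def_cone" using w c by (rule pos_def_cone_scaleR)
  have "order_related (c *\<^sub>R w) (c *\<^sub>R \<phi> w)"
    unfolding order_related_def scaleR_scaleR
    using order_related_image[OF w] c unfolding order_related_def by simp
  then show ?thesis
    using order_related_unique[OF cw] pos_def_cone_scaleR[OF image_in_cone[OF w] c] by simp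
qed

lemma order_embedding:
  "x \<in> pos_def_cone \<Longrightarrow> y \<in> pos_def_cone \<Longrightarrow> nonneg (y - x) \<longleftrightarrow> nonneg (\<phi> y - \<phi> x)"
  using order_relatedD[OF order_related_image] by blast

lemma inj_on_cone: "inj_on \<phi> pos_def_cone"
proof (rule inj_onI)
  fix x y assume "x \<in> pos_def_cone" "y \<in> pos_def_cone" "\<phi> x = \<phi> y"
  then have "nonneg (x - y)" "nonneg (y - x)" using order_embedding by (metis diff_self nonneg_zero)+
  then show "x = y" using nonneg_antisym[of "x - y"] by simp
qed

lemma cone_map: "cone_map \<phi>"
  by unfold_locales
    (simp_all add: image_in_cone mono_image image_scaleR image_one image_fourth_power)

lemma cone_map_inverse: "cone_map (inv_into pos_def_cone \<phi>)"
proof -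
  let ?\<psi> = "inv_into pos_def_cone \<phi>"
  have closed: "?\<psi> y \<in> pos_def_cone" and right: "\<phi> (?\<psi> y) = y" if "y \<in> pos_def_cone" for y
    using that onto by (simp_all add: inv_into_into f_inv_into_f)
  have left: "?\<psi> (\<phi> x) = x" if "x \<in> pos_def_cone" for x
    using that inj_on_cone by simp
  have x4: "x ^ 4 \<in> pos_def_cone" if "x \<in> pos_def_cone" for x :: 'a
    using pos_def_cone_square[OF pos_def_cone_square[OF that]] by (simp add: power4_eq_xxxx mult.assoc)
  show ?thesis
  proof
    fix x y :: 'b and r :: real
    assume x: "x \<in> pos_def_cone"
    show "?\<psi> x \<in> pos_def_cone" using closed x by blast
    show "nonneg (?\<psi> y - ?\<psi> x)" if "y \<in> pos_def_cone" "nonneg (y - x)"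
      using order_embedding[OF closed[OF x] closed[OF that(1)]] that x by (simp add: right)
    show "?\<psi> (r *\<^sub>R x) = r *\<^sub>R ?\<psi> x" if "r > 0"
      using left[OF pos_def_cone_scaleR[OF closed[OF x] that]] image_scaleR[OF closed[OF x] that] right[OF x]
      by simp
    show "?\<psi> (x ^ 4) = ?\<psi> x ^ 4"
      using left[OF x4[OF closed[OF x]]] image_fourth_power[OF closed[OF x]] right[OF x] by simp
  next
    show "?\<psi> 1 = 1" using left[OF pos_def_cone_one] image_one by simp
  qed
qed

end

section \<open>The Mazur--Ulam theorem\<close>

text \<open>The inverse map is a parameter, so that isometries between subsets can be composed and
  inverted explicitly.\<close>

definition isometric_pair :: "'a::real_normed_vector set \<Rightarrow> 'b::real_normed_vector set
    \<Rightarrow> ('a \<Rightarrow> 'b) \<Rightarrow> ('b \<Rightarrow> 'a) \<Rightarrow> bool" where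
  "isometric_pair S T f g \<longleftrightarrow>
     (\<forall>x\<in>S. f x \<in> T \<and> g (f x) = x) \<and> (\<forall>y\<in>T. g y \<in> S \<and> f (g y) = y) \<and>
     (\<forall>x\<in>S. \<forall>y\<in>S. norm (f x - f y) = norm (x - y))"

lemma isometric_pairD:
  assumes "isometric_pair S T f g"
  shows "x \<in> S \<Longrightarrow> f x \<in> T" "x \<in> S \<Longrightarrow> g (f x) = x" "y \<in> T \<Longrightarrow> g y \<in> S" "y \<in> T \<Longrightarrow> f (g y) = y"
    "x \<in> S \<Longrightarrow> z \<in> S \<Longrightarrow> norm (f x - f z) = norm (x - z)"
  using assms unfolding isometric_pair_def by blast+

lemma isometric_pair_inverse:
  assumes "isometric_pair S T f g"
  shows "isometric_pair T S g f"
  unfolding isometric_pair_def using isometric_pairD[OF assms] by metis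

lemma isometric_pair_comp:
  assumes "isometric_pair S T f g" "isometric_pair T U f' g'"
  shows "isometric_pair S U (\<lambda>x. f' (f x)) (\<lambda>y. g (g' y))"
  unfolding isometric_pair_def using isometric_pairD[OF assms(1)] isometric_pairD[OF assms(2)] by simp

lemma isometric_pair_reflection:
  assumes "subspace S" "a \<in> S" "b \<in> S"
  shows "isometric_pair S S (\<lambda>x. a + b - x) (\<lambda>x. a + b - x)"
  using assms by (auto simp: isometric_pair_def norm_minus_commute subspace_add subspace_diff)

text \<open>Vaisala's argument: composing \<open>g\<close> with its conjugate under the reflection in the
  midpoint doubles the displacement of the midpoint, which stays bounded.\<close>

lemma isometric_pair_fixes_midpoint:
  assumes S: "subspace S" "a \<in> S" "b \<in> S"
    and g: "isometric_pair S S g h" "g a = a" "g b = b"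
  shows "g ((1/2) *\<^sub>R (a + b)) = (1/2) *\<^sub>R (a + b)"
proof -
  define z where "z = (1/2) *\<^sub>R (a + b)"
  have z: "z \<in> S" using S by (simp add: z_def subspace_add subspace_scale)
  have zz: "a + b = z + z" by (simp add: z_def flip: scaleR_add_left)
  let ?r = "\<lambda>x. a + b - x"
  note r = isometric_pair_reflection[OF S]
  \<comment> \<open>The claim is generalised over \<open>g\<close> and \<open>h\<close> because the
    induction passes to \<open>?k\<close>, which fixes \<open>a\<close> and \<open>b\<close> since
    the reflection exchanges them. The base case is the triangle inequality through
    \<open>a\<close>.\<close>
  have bound: "2 ^ n * norm (g z - z) \<le> 2 * norm (z - a)"
    if "isometric_pair S S g h" "g a = a" "g b = b" for n g h
    using that
  proof (induction n arbitrary: g h)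
    case 0
    have "norm (g z - g a) = norm (z - a)" using isometric_pairD(5)[OF "0.prems"(1)] z S by blast
    then show ?case using norm_triangle_ineq[of "g z - g a" "a - z"] "0.prems"
      by (simp add: norm_minus_commute)
  next
    case (Suc n)
    note g = Suc.prems
    let ?k = "\<lambda>x. ?r (h (?r (g x)))" and ?l = "\<lambda>x. h (?r (g (?r x)))"
    have p: "isometric_pair S S ?k ?l"
      using isometric_pair_comp[OF isometric_pair_comp[OF isometric_pair_comp[OF g(1) r]
            isometric_pair_inverse[OF g(1)]] r] by simp
    have hab: "h a = a" "h b = b" using isometric_pairD(2)[OF g(1)] g S by metis+
    have gz: "g z \<in> S" "?r (g z) \<in> S" using isometric_pairD(1)[OF g(1) z] isometric_pairD(1)[OF r] by blast+
    have "norm (?k z - z) = norm (z - h (?r (g z)))" by (simp add: zz)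
    also have "\<dots> = norm (g z - g (h (?r (g z))))"
      using isometric_pairD(3,5)[OF g(1)] z gz by simp
    also have "g (h (?r (g z))) = ?r (g z)" using isometric_pairD(4)[OF g(1)] gz by blast
    also have "g z - ?r (g z) = 2 *\<^sub>R (g z - z)" by (simp add: zz scaleR_2)
    finally have "norm (?k z - z) = 2 * norm (g z - z)" by simp
    moreover have "2 ^ n * norm (?k z - z) \<le> 2 * norm (z - a)"
      using p by (rule Suc.IH) (simp_all add: g hab)
    ultimately show ?case by simp
  qed
  have "norm (g z - z) = 0"
  proof (rule ccontr)
    assume "norm (g z - z) \<noteq> 0"
    then have "norm (g z - z) > 0" by simp
    moreover obtain n where "2 * norm (z - a) / norm (g z - z) < 2 ^ n"
      using real_arch_pow[of 2 "2 * norm (z - a) / norm (g z - z)"] by auto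
    ultimately show False using bound[OF g, of n] by (simp add: field_simps)
  qed
  then show ?thesis by (simp add: z_def)
qed

text \<open>Mapping by \<open>f\<close>, reflecting, returning by \<open>g\<close> and reflecting
  again fixes \<open>a\<close> and \<open>b\<close>, hence also \<open>z\<close>. So the reflection
  in the midpoint of \<open>f a\<close> and \<open>f b\<close> fixes \<open>f z\<close>.\<close>

lemma mazur_ulam_midpoint:
  assumes S: "subspace S" "a \<in> S" "b \<in> S" and T: "subspace T"
    and f: "isometric_pair S T f g"
  shows "f ((1/2) *\<^sub>R (a + b)) = (1/2) *\<^sub>R (f a + f b)"
proof -
  define z where "z = (1/2) *\<^sub>R (a + b)"
  have z: "z \<in> S" using S by (simp add: z_def subspace_add subspace_scale)
  have zz: "a + b = z + z" by (simp add: z_def flip: scaleR_add_left)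
  note fD = isometric_pairD[OF f]
  let ?r = "\<lambda>x. a + b - x" and ?s = "\<lambda>y. f a + f b - y"
  have fab: "f a \<in> T" "f b \<in> T" using fD(1) S by blast+
  let ?k = "\<lambda>x. ?r (g (?s (f x)))" and ?l = "\<lambda>x. g (?s (f (?r x)))"
  have "isometric_pair S S ?k ?l"
    using isometric_pair_comp[OF isometric_pair_comp[OF isometric_pair_comp[OF f
          isometric_pair_reflection[OF T fab]] isometric_pair_inverse[OF f]]
        isometric_pair_reflection[OF S]] by simp
  then have "?k z = z"
    unfolding z_def using fD(2) S by (intro isometric_pair_fixes_midpoint) simp_all
  then have "g (?s (f z)) = z" unfolding zz by (simp add: algebra_simps)
  moreover have "?s (f z) \<in> T" using T fab fD(1)[OF z] by (simp add: subspace_add subspace_diff)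
  ultimately have "?s (f z) = f z" using fD(4) by metis
  then have "f a + f b = 2 *\<^sub>R f z" by (simp add: scaleR_2 algebra_simps)
  then show ?thesis by (simp add: z_def)
qed

lemma mazur_ulam_additive:
  assumes S: "subspace S" and T: "subspace T" and f: "isometric_pair S T f g" and f0: "f 0 = 0"
    and xy: "x \<in> S" "y \<in> S"
  shows "f (x + y) = f x + f y"
proof -
  note mid = mazur_ulam_midpoint[OF S _ _ T f]
  have "f ((1/2) *\<^sub>R (x + y + 0)) = (1/2) *\<^sub>R (f (x + y) + f 0)"
    using xy S by (intro mid) (simp_all add: subspace_add subspace_0)
  moreover have "f ((1/2) *\<^sub>R (x + y)) = (1/2) *\<^sub>R (f x + f y)" using xy by (rule mid)
  ultimately show ?thesis by (simp add: f0)
qed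

text \<open>The defect \<open>d\<close> is additive in the scalar and vanishes on the integers, so
  it depends only on \<open>frac s\<close> and is bounded; a bounded additive function is
  zero.\<close>

lemma additive_nonexpansive_homogeneous:
  fixes f :: "'a::real_normed_vector \<Rightarrow> 'b::real_normed_vector"
  assumes S: "subspace S" and add: "\<And>x y. x \<in> S \<Longrightarrow> y \<in> S \<Longrightarrow> f (x + y) = f x + f y"
    and bound: "\<And>x. x \<in> S \<Longrightarrow> norm (f x) \<le> norm x" and x: "x \<in> S"
  shows "f (r *\<^sub>R x) = r *\<^sub>R f x"
proof -
  define d where "d = (\<lambda>s. f (s *\<^sub>R x) - s *\<^sub>R f x)"
  have sx: "s *\<^sub>R x \<in> S" for s using S x by (simp add: subspace_scale)
  have d_add: "d (s + t) = d s + d t" for s t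
    using add[OF sx sx, of s t] by (simp add: d_def algebra_simps)
  have d1: "d 1 = 0" by (simp add: d_def)
  have d0: "d 0 = 0" using d_add[of 0 0] by simp
  have d_minus: "d (- s) = - d s" for s using d_add[of s "- s"] d0 by (simp add: eq_neg_iff_add_eq_0 add.commute)
  have d_nat: "d (real n * s) = real n *\<^sub>R d s" for n s
  proof (induction n)
    case (Suc n)
    then show ?case using d_add[of s "real n * s"] by (simp add: algebra_simps)
  qed (simp add: d0)
  have d_int: "d (of_int i) = 0" for i
  proof (cases i)
    case (nonneg n)
    then show ?thesis using d_nat[of n 1] d1 by simp
  next
    case (neg n)
    then show ?thesis using d_nat[of "Suc n" 1] d1 d_minus[of "real (Suc n)"] by simp
  qed
  have bounded: "norm (d s) \<le> 2 * norm x" for s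
  proof -
    have "d s = d (frac s)"
      using d_add[of "of_int \<lfloor>s\<rfloor>" "frac s"] d_int by (simp add: frac_def)
    moreover have "norm (d (frac s)) \<le> norm (f (frac s *\<^sub>R x)) + norm (frac s *\<^sub>R f x)"
      unfolding d_def by (rule norm_triangle_ineq4)
    moreover have "norm (f (frac s *\<^sub>R x)) \<le> norm (frac s *\<^sub>R x)" by (rule bound[OF sx])
    moreover have fr: "\<bar>frac s\<bar> \<le> 1" using frac_lt_1[of s] by (simp add: less_imp_le)
    then have "norm (frac s *\<^sub>R x) \<le> norm x" by (simp add: mult_left_le_one_le)
    moreover have "norm (frac s *\<^sub>R f x) \<le> norm (f x)" using fr by (simp add: mult_left_le_one_le)
    moreover have "norm (f x) \<le> norm x" by (rule bound[OF x])
    ultimately show ?thesis by simp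
  qed
  have "norm (d r) = 0"
  proof (rule ccontr)
    assume "norm (d r) \<noteq> 0"
    then have pos: "norm (d r) > 0" by simp
    obtain n where "2 * norm x / norm (d r) < real n" using reals_Archimedean2 by blast
    then have "2 * norm x < real n * norm (d r)" using pos by (simp add: field_simps)
    also have "\<dots> = norm (d (real n * r))" by (simp add: d_nat)
    finally show False using bounded[of "real n * r"] by simp
  qed
  then show ?thesis by (simp add: d_def)
qed

lemma subspace_selfadjoint: "subspace {h :: 'a::unital_cstar_algebra. star h = h}"
  by (auto simp: subspace_def star_add star_scaleR)

section \<open>Kadison's inequality\<close>

text \<open>The Bernstein operator \<open>\<Sum>k\<le>n. (n choose k) g(k) h\<^sup>k (1 - h)\<^bsup>n-k\<^esup>\<close>, by recursion on \<open>n\<close>.\<close>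

primrec bernstein :: "'a::real_algebra_1 \<Rightarrow> nat \<Rightarrow> (nat \<Rightarrow> real) \<Rightarrow> 'a" where
  "bernstein h 0 g = of_real (g 0)"
| "bernstein h (Suc n) g = h * bernstein h n (\<lambda>k. g (Suc k)) + (1 - h) * bernstein h n g"

lemma bernstein_commutes:
  assumes "z * h = h * z"
  shows "z * bernstein h n g = bernstein h n g * z"
proof (induction n arbitrary: g)
  case 0
  show ?case by (simp add: of_real_def)
next
  case (Suc n)
  have "z * (h * a) = h * a * z" if "z * a = a * z" for a using that assms by (metis mult.assoc)
  then show ?case using Suc by (simp add: algebra_simps)
qed

lemma star_bernstein:
  fixes h :: "'a::unital_cstar_algebra"
  assumes "star h = h"
  shows "star (bernstein h n g) = bernstein h n g"
proof (induction n arbitrary: g)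
  case (Suc n)
  have comm: "(1 - h) * bernstein h n g = bernstein h n g * (1 - h)" for g
    by (rule bernstein_commutes) (simp add: algebra_simps)
  have "star ((1 - h) * bernstein h n g) = (1 - h) * bernstein h n g" for g
    by (intro star_commuting_product comm) (simp_all add: star_diff assms Suc)
  moreover have "star (h * bernstein h n g) = h * bernstein h n g" for g
    by (intro star_commuting_product bernstein_commutes assms Suc refl)
  ultimately show ?case by (simp add: star_add)
qed simp

lemma bernstein_add:
  "bernstein h n (\<lambda>k. g k + g' k) = bernstein h n g + bernstein h n g'"
  by (induction n arbitrary: g g') (simp_all add: algebra_simps)

lemma bernstein_one: "bernstein h n (\<lambda>_. 1) = 1"
  by (induction n) simp_all

lemma bernstein_linear: "bernstein h n real = real n *\<^sub>R h"
proof (induction n)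
  case (Suc n)
  have "bernstein h n (\<lambda>k. real (Suc k)) = real n *\<^sub>R h + 1"
    using bernstein_add[of h n real "\<lambda>_. 1"] Suc by (simp add: bernstein_one add.commute)
  then show ?case using Suc by (simp add: algebra_simps)
qed simp

text \<open>The second moment of a binomial law with parameter \<open>h\<close>. Divided by
  \<open>n^2\<close> it differs from \<open>h * h\<close> by \<open>(h - h * h) / n\<close>, which
  tends to zero.\<close>

lemma bernstein_square:
  "bernstein h n (\<lambda>k. (real k)\<^sup>2) = (real n * (real n - 1)) *\<^sub>R (h * h) + real n *\<^sub>R h"
proof (induction n)
  case (Suc n)
  have "(\<lambda>k. (real (Suc k))\<^sup>2) = (\<lambda>k. (real k)\<^sup>2 + ((real k + real k) + 1))"
    by (simp add: power2_eq_square algebra_simps)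
  then have shifted: "bernstein h n (\<lambda>k. (real (Suc k))\<^sup>2)
      = bernstein h n (\<lambda>k. (real k)\<^sup>2) + ((real n *\<^sub>R h + real n *\<^sub>R h) + 1)"
    by (simp only: bernstein_add bernstein_one bernstein_linear)
  show ?case unfolding bernstein.simps shifted Suc by (simp add: algebra_simps)
qed simp

text \<open>Only selfadjoint arguments are constrained, because \<open>cone_deriv\<close> is
  controlled only there.\<close>

locale unital_positive_map =
  fixes f :: "'a::unital_cstar_algebra \<Rightarrow> 'b::unital_cstar_algebra"
  assumes additive: "star h = h \<Longrightarrow> star k = k \<Longrightarrow> f (h + k) = f h + f k"
    and scaleR: "star h = h \<Longrightarrow> f (r *\<^sub>R h) = r *\<^sub>R f h"
    and unit: "f 1 = 1"
    and positive: "nonneg h \<Longrightarrow> nonneg (f h)"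
    and selfadjoint: "star h = h \<Longrightarrow> star (f h) = f h"
begin

lemma of_real_eq: "f (of_real r) = of_real r"
  using scaleR[of 1 r] by (simp add: of_real_def unit)

lemma minus: "star h = h \<Longrightarrow> f (- h) = - f h"
  using scaleR[of h "-1"] by simp

lemma diff: "star h = h \<Longrightarrow> star k = k \<Longrightarrow> f (h - k) = f h - f k"
  using additive[of h "- k"] by (simp add: star_minus minus)

text \<open>With \<open>w_k\<close> denoting \<open>w\<close> times the \<open>k\<close>-th
  Bernstein polynomial of \<open>h\<close>, the expression is the sum of the terms
  \<open>(g k - m) * f w_k * (g k - m)\<close>. The weight \<open>w\<close> is generalised because
  the recursion multiplies it by \<open>h\<close> or by \<open>1 - h\<close>.\<close>

lemma bernstein_variance:
  assumes h: "nonneg h" "nonneg (1 - h)" and m: "star m = m"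
    and w: "nonneg w" "w * h = h * w"
  shows "nonneg (f (w * bernstein h n (\<lambda>k. (g k)\<^sup>2)) - m * f (w * bernstein h n g)
    - f (w * bernstein h n g) * m + m * f w * m)"
  using w
proof (induction n arbitrary: w g)
  case 0
  have sw: "star w = w" using 0 nonneg_star by blast
  have "nonneg ((of_real (g 0) - m) * f w * (of_real (g 0) - m))"
    using m 0 by (intro nonneg_conj positive) (simp_all add: star_diff)
  moreover have "w * of_real r = r *\<^sub>R w" for r by (simp add: of_real_def)
  ultimately show ?case
    using sw by (simp add: scaleR of_real_def algebra_simps power2_eq_square)
next
  case (Suc n)
  have sh: "star h = h" using h nonneg_star by blast
  have sw: "star w = w" using Suc.prems nonneg_star by blast
  have w: "nonneg w" "w * h = h * w" by fact+
  have w': "w * (1 - h) = (1 - h) * w" using w(2) by (simp add: algebra_simps)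
  have wh: "nonneg (w * h)" "w * h * h = h * (w * h)"
    using nonneg_mult[OF w(1) h(1) w(2)] w(2) by (simp, metis mult.assoc)
  have "(1 - h) * h = h * (1 - h)" by (simp add: algebra_simps)
  then have wh': "nonneg (w * (1 - h))" "w * (1 - h) * h = h * (w * (1 - h))"
    using nonneg_mult[OF w(1) h(2) w'] w(2) by (simp, metis mult.assoc)
  have sa: "star (v * bernstein h n g) = v * bernstein h n g" if "nonneg v" "v * h = h * v" for v g
    using that sh by (intro star_commuting_product bernstein_commutes star_bernstein) (simp_all add: nonneg_star)
  have split: "f (w * bernstein h (Suc n) g)
      = f (w * h * bernstein h n (\<lambda>k. g (Suc k))) + f (w * (1 - h) * bernstein h n g)" for g
  proof -
    have "w * bernstein h (Suc n) g
        = w * h * bernstein h n (\<lambda>k. g (Suc k)) + w * (1 - h) * bernstein h n g"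
      by (simp only: bernstein.simps distrib_left mult.assoc)
    then show ?thesis using additive[OF sa[OF wh] sa[OF wh']] by simp
  qed
  have "f w = f (w * h) + f (w * (1 - h))"
    using additive[OF nonneg_star[OF wh(1)] nonneg_star[OF wh'(1)]] by (simp add: right_diff_distrib)
  then have "m * f w * m = m * f (w * h) * m + m * f (w * (1 - h)) * m" by (simp add: algebra_simps)
  moreover note nonneg_add[OF Suc.IH[OF wh, of "\<lambda>k. g (Suc k)"] Suc.IH[OF wh', of g]]
  ultimately show ?case unfolding split by (simp add: algebra_simps)
qed

lemma kadison_unit_interval:
  assumes h: "nonneg h" "nonneg (1 - h)"
  shows "nonneg (f (h * h) - f h * f h)"
proof (rule nonneg_limit)
  have sh: "star h = h" using h nonneg_star by blast
  have shh: "star (h * h) = h * h" by (simp add: star_mult sh)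
  let ?a = "\<lambda>n. f (h * h) - f h * f h + inverse (real (Suc n)) *\<^sub>R (f h - f (h * h))"
  have "?a \<longlonglongrightarrow> f (h * h) - f h * f h + 0 *\<^sub>R (f h - f (h * h))"
    by (intro tendsto_intros LIMSEQ_inverse_real_of_nat)
  then show "?a \<longlonglongrightarrow> f (h * h) - f h * f h" by simp
  have "nonneg (?a n)" for n
  proof -
    let ?N = "real (Suc n)"
    \<comment> \<open>This is the image of the first moment, so the two cross terms and the last
      term combine to \<open>- m * m\<close>.\<close>
    define m where "m = ?N *\<^sub>R f h"
    have "star m = m" using sh by (simp add: m_def star_scaleR selfadjoint)
    then have "nonneg (f (1 * bernstein h (Suc n) (\<lambda>k. (real k)\<^sup>2)) - m * f (1 * bernstein h (Suc n) real)
        - f (1 * bernstein h (Suc n) real) * m + m * f 1 * m)"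
      using h by (intro bernstein_variance) (simp_all add: nonneg_one)
    moreover have "f (1 * bernstein h (Suc n) real) = m"
      using sh by (simp only: bernstein_linear m_def scaleR mult_1)
    moreover have "f (1 * bernstein h (Suc n) (\<lambda>k. (real k)\<^sup>2))
        = (?N * (?N - 1)) *\<^sub>R f (h * h) + ?N *\<^sub>R f h"
      unfolding bernstein_square mult_1 using sh shh
      by (subst additive) (simp_all only: scaleR star_scaleR)
    ultimately have "nonneg ((?N * (?N - 1)) *\<^sub>R f (h * h) + ?N *\<^sub>R f h - m * m)"
      by (simp add: unit)
    then have "nonneg ((1 / (?N * ?N)) *\<^sub>R ((?N * (?N - 1)) *\<^sub>R f (h * h) + ?N *\<^sub>R f h - m * m))"
      by (rule nonneg_scaleR) simp
    moreover have "(1 / (?N * ?N)) *\<^sub>R ((?N * (?N - 1)) *\<^sub>R f (h * h) + ?N *\<^sub>R f h - m * m) = ?a n"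
    proof -
      have N: "?N \<noteq> 0" by simp
      have "1 / (?N * ?N) * (?N * (?N - 1)) = 1 - inverse ?N" "1 / (?N * ?N) * ?N = inverse ?N"
        "1 / (?N * ?N) * (?N * ?N) = 1"
        using N by (simp_all add: field_simps del: of_nat_Suc)
      then have scale: "(1 / (?N * ?N)) *\<^sub>R ((?N * (?N - 1)) *\<^sub>R u + ?N *\<^sub>R v - (?N * ?N) *\<^sub>R x)
          = (1 - inverse ?N) *\<^sub>R u + inverse ?N *\<^sub>R v - x" for u v x :: 'b
        by (simp only: scaleR_add_right scaleR_diff_right scaleR_scaleR scaleR_one)
      have mm: "m * m = (?N * ?N) *\<^sub>R (f h * f h)" by (simp add: m_def)
      show ?thesis unfolding mm scale by (simp add: algebra_simps del: of_nat_Suc)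
    qed
    ultimately show ?thesis by simp
  qed
  then show "eventually (\<lambda>n. nonneg (?a n)) sequentially" by (intro always_eventually) blast
qed simp

text \<open>The defect \<open>f (h * h) - f h * f h\<close> is unchanged by scalar translations and
  is multiplied by \<open>e * e\<close> under scaling, so an affine change of variable reduces to
  the unit interval.\<close>

lemma kadison:
  assumes h: "star h = h"
  shows "nonneg (f (h * h) - f h * f h)"
proof -
  define c where "c = norm h + 1"
  \<comment> \<open>\<open>c + h\<close> lies between 0 and \<open>2 * c\<close>, so this factor
    brings it into the unit interval.\<close>
  define e where "e = 1 / (2 * c)"
  have c: "c > 0" "norm h \<le> c" by (simp_all add: c_def add_nonneg_pos)
  have e: "e > 0" "e * c = 1/2" using c by (simp_all add: e_def)
  define k where "k = e *\<^sub>R (of_real c + h)"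
  have hh: "star (h * h) = h * h" by (simp add: star_mult h)
  have k0: "nonneg k" using e c h by (simp add: k_def nonneg_scaleR nonneg_of_real_plus)
  have "e *\<^sub>R (of_real c - h) = (2 * (e * c)) *\<^sub>R 1 - k"
    by (simp add: k_def of_real_def algebra_simps flip: scaleR_add_left)
  then have "1 - k = e *\<^sub>R (of_real c - h)" using e by simp
  then have "nonneg (1 - k)" using e c h by (simp add: nonneg_scaleR nonneg_of_real_minus)
  then have "nonneg (f (k * k) - f k * f k)" using k0 by (intro kadison_unit_interval)
  moreover have "f k = e *\<^sub>R (of_real c + f h)"
    using h by (simp add: k_def scaleR additive star_add of_real_eq)
  moreover have "k * k = (e * e) *\<^sub>R (h * h + (c *\<^sub>R h + (c *\<^sub>R h + of_real (c * c))))"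
    by (simp add: k_def of_real_def algebra_simps)
  moreover have "f ((e * e) *\<^sub>R (h * h + (c *\<^sub>R h + (c *\<^sub>R h + of_real (c * c)))))
      = (e * e) *\<^sub>R (f (h * h) + (c *\<^sub>R f h + (c *\<^sub>R f h + of_real (c * c))))"
    using h hh by (simp only: scaleR additive star_add star_scaleR star_of_real of_real_eq)
  moreover have "(e *\<^sub>R (of_real c + f h)) * (e *\<^sub>R (of_real c + f h))
      = (e * e) *\<^sub>R (f h * f h + (c *\<^sub>R f h + (c *\<^sub>R f h + of_real (c * c))))"
    by (simp add: of_real_def algebra_simps)
  moreover have "(e * e) *\<^sub>R (u + w) - (e * e) *\<^sub>R (v + w) = (e * e) *\<^sub>R (u - v)" for u v w :: 'b
    by (simp add: algebra_simps)
  ultimately have "nonneg ((e * e) *\<^sub>R (f (h * h) - f h * f h))"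
    by metis
  from nonneg_scaleR[OF this, of "1 / (e * e)"] show ?thesis using e by simp
qed

end

text \<open>Kadison for \<open>g\<close> at \<open>f h\<close> reads
  \<open>h * h \<le> g (f h * f h)\<close>; applying the positive map \<open>f\<close> gives the
  reverse of Kadison for \<open>f\<close>.\<close>

lemma positive_inverse_pair_square:
  assumes f: "unital_positive_map f" and g: "unital_positive_map g"
    and gf: "\<And>h. star h = h \<Longrightarrow> g (f h) = h" and fg: "\<And>k. star k = k \<Longrightarrow> f (g k) = k"
    and h: "star h = h"
  shows "f (h * h) = f h * f h"
proof -
  interpret f: unital_positive_map f by fact
  interpret g: unital_positive_map g by fact
  have sf: "star (f h) = f h" by (rule f.selfadjoint[OF h])
  have ff: "star (f h * f h) = f h * f h" by (simp add: star_mult sf)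
  have hh: "star (h * h) = h * h" by (simp add: star_mult h)
  have "nonneg (g (f h * f h) - h * h)" using g.kadison[OF sf] by (simp add: gf h)
  then have "nonneg (f (g (f h * f h) - h * h))" by (rule f.positive)
  then have "nonneg (f h * f h - f (h * h))"
    using ff hh by (simp add: f.diff fg g.selfadjoint)
  moreover have "nonneg (f (h * h) - f h * f h)" by (rule f.kadison[OF h])
  ultimately show ?thesis using nonneg_antisym[of "f (h * h) - f h * f h"] by simp
qed

section \<open>The derivative at the unit is the whole map\<close>

text \<open>An operator Bernoulli inequality. It will bound \<open>4^n * (y - 1)\<close> by
  \<open>x - 1\<close> for roots \<open>y \<ge> 1\<close> with \<open>y^(4^n) = x\<close>, uniformly
  in \<open>n\<close>.\<close>

lemma nonneg_bernoulli:
  assumes h: "nonneg h"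
  shows "nonneg ((1 + h) ^ n - 1 - real n *\<^sub>R h)"
proof (induction n)
  case (Suc n)
  have comm: "(1 + h) ^ n * h = h * (1 + h) ^ n" by (rule power_commuting_commutes) (simp add: algebra_simps)
  have "nonneg (((1 + h) ^ n - 1 - real n *\<^sub>R h) * (1 + h))"
    using Suc h nonneg_one comm by (intro nonneg_mult nonneg_add) (simp_all add: algebra_simps)
  moreover have "nonneg (real n *\<^sub>R (h * h))"
    using h by (intro nonneg_scaleR nonneg_square nonneg_star) simp_all
  ultimately have "nonneg (((1 + h) ^ n - 1 - real n *\<^sub>R h) * (1 + h) + real n *\<^sub>R (h * h))"
    by (rule nonneg_add)
  moreover have "((1 + h) ^ n - 1 - real n *\<^sub>R h) * (1 + h) + real n *\<^sub>R (h * h)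
      = (1 + h) ^ Suc n - 1 - real (Suc n) *\<^sub>R h"
    using comm by (simp add: algebra_simps)
  ultimately show ?case by simp
qed (simp add: nonneg_zero)

lemma root_ge_one:
  assumes "nonneg (x - 1)"
  shows "\<exists>y. nonneg (y - 1) \<and> y ^ (4 ^ n) = x"
proof (induction n)
  case 0
  show ?case using assms by simp
next
  case (Suc n)
  then obtain y where y: "nonneg (y - 1)" "y ^ (4 ^ n) = x" by blast
  obtain s where s: "nonneg (s - 1)" "s * s = y" using sqrt_ge_one[OF y(1)] by metis
  obtain r where r: "nonneg (r - 1)" "r * r = s" using sqrt_ge_one[OF s(1)] by metis
  have "r ^ 4 = y" using r(2) s(2) by (simp add: power4_eq_xxxx mult.assoc)
  then have "r ^ (4 ^ Suc n) = x" using y(2) by (simp add: power_mult)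
  then show ?case using r(1) by blast
qed

lemma norm_power_diff_le:
  fixes a b :: "'a::real_normed_algebra_1"
  assumes "norm a \<le> r" "norm b \<le> r" "1 \<le> r"
  shows "norm (a ^ n - b ^ n) \<le> real n * r ^ n * norm (a - b)"
proof (induction n)
  case (Suc n)
  have "a ^ Suc n - b ^ Suc n = a * (a ^ n - b ^ n) + (a - b) * b ^ n" by (simp add: algebra_simps)
  then have "norm (a ^ Suc n - b ^ Suc n) \<le> norm a * norm (a ^ n - b ^ n) + norm (a - b) * norm (b ^ n)"
    by (simp only:) (intro norm_triangle_le add_mono norm_mult_ineq)
  also have "\<dots> \<le> r * (real n * r ^ n * norm (a - b)) + norm (a - b) * (r * r ^ n)"
  proof (intro add_mono mult_mono Suc)
    have "norm (b ^ n) \<le> r ^ n"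
      using norm_power_ineq[of b n] power_mono[OF assms(2), of n] by simp
    also have "\<dots> \<le> r * r ^ n" using assms(3) by (simp add: mult_le_cancel_right1)
    finally show "norm (b ^ n) \<le> r * r ^ n" .
  qed (use assms in simp_all)
  finally show ?case by (simp add: algebra_simps)
qed simp

lemma (in cone_map) power_four_power:
  "x \<in> pos_def_cone \<Longrightarrow> \<phi> (x ^ (4 ^ n)) = \<phi> x ^ (4 ^ n)"
proof (induction n arbitrary: x)
  case (Suc n)
  have "x ^ 4 \<in> pos_def_cone"
    using pos_def_cone_square[OF pos_def_cone_square[OF Suc.prems]] by (simp add: power4_eq_xxxx mult.assoc)
  then show ?case using Suc fourth_power by (simp add: power_mult)
qed simp

text \<open>Write \<open>x = y\<^sup>N\<close> with \<open>N = 4\<^sup>n\<close>. Then \<open>\<phi> y - f y\<close> is of order \<open>N\<^sup>-\<^sup>2\<close> since \<open>y\<close> is within order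
  \<open>N\<^sup>-\<^sup>1\<close> of the unit, and taking \<open>N\<close>-th powers costs only a factor of order \<open>N\<close>.\<close>

lemma (in cone_map) eq_deriv_ge_one:
  assumes f: "unital_positive_map (cone_deriv \<phi>)"
    and square: "\<And>h. star h = h \<Longrightarrow> cone_deriv \<phi> (h * h) = cone_deriv \<phi> h * cone_deriv \<phi> h"
    and x: "nonneg (x - 1)"
  shows "\<phi> x = cone_deriv \<phi> x"
proof -
  let ?f = "cone_deriv \<phi>"
  interpret f: unital_positive_map ?f by fact
  have four: "?f (y ^ 4) = ?f y ^ 4" if "star y = y" for y
    using square[of y] square[of "y * y"] that by (simp add: star_mult power4_eq_xxxx mult.assoc)
  have f_pow: "?f (y ^ (4 ^ n)) = ?f y ^ (4 ^ n)" if "star y = y" for y n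
    using that
  proof (induction n arbitrary: y)
    case (Suc n)
    then show ?case using four[of y] by (simp add: power_mult star_power)
  qed simp
  define M where "M = norm (x - 1)"
  \<comment> \<open>The sequence is constant, so a bound of order \<open>4^-n\<close> for large
    \<open>n\<close> makes the two values equal.\<close>
  have "(\<lambda>n::nat. \<phi> x - ?f x) \<longlonglongrightarrow> 0"
  proof (rule null_by_quarter_powers)
    show "eventually (\<lambda>n. norm (\<phi> x - ?f x) \<le> (1/4) ^ n * (exp M * 4 * M\<^sup>2)) sequentially"
      using eventually_quarter_power_le[of "1/4" M]
    proof (rule eventually_mono)
      fix n assume n: "(1/4) ^ n * M \<le> 1/4"
      define t :: real where "t = (1/4) ^ n"
      have t: "t > 0" "4 ^ n * t = 1" by (simp_all add: t_def flip: power_mult_distrib)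
      obtain y where y: "nonneg (y - 1)" "y ^ (4 ^ n) = x" using root_ge_one[OF x] by blast
      \<comment> \<open>\<open>h\<close> depends on \<open>n\<close>, but Bernoulli keeps its norm
        below \<open>M\<close>, so \<open>y\<close> stays within \<open>4^-n * M\<close> of the
        unit.\<close>
      define h where "h = (4 ^ n :: real) *\<^sub>R (y - 1)"
      have y_eq: "y = 1 + t *\<^sub>R h" using t by (simp add: h_def mult.commute)
      have h0: "nonneg h" unfolding h_def by (rule nonneg_scaleR[OF y(1)]) simp
      have sh: "star h = h" by (rule nonneg_star[OF h0])
      have "nonneg ((1 + (y - 1)) ^ (4 ^ n) - 1 - real (4 ^ n) *\<^sub>R (y - 1))"
        by (rule nonneg_bernoulli[OF y(1)])
      then have "nonneg ((x - 1) - h)" using y(2) by (simp add: h_def)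
      moreover have "nonneg (of_real M - (x - 1))"
        using nonneg_star[OF x] by (intro nonneg_of_real_minus) (simp_all add: M_def)
      ultimately have "nonneg (of_real M - h)" using nonneg_add by fastforce
      then have hM: "norm h \<le> M" using norm_nonneg_le_iff[OF h0, of M] by (simp add: M_def)
      have thM: "t * norm h \<le> t * M" using hM t by (intro mult_left_mono) simp_all
      have th: "(1/4) ^ n * norm h \<le> 1/4" using n thM unfolding t_def by linarith
      have fy: "?f y = 1 + t *\<^sub>R ?f h"
        unfolding y_eq using sh by (simp add: f.additive f.scaleR f.unit star_scaleR)
      have near: "star y = y" "norm (y - 1) \<le> 1/2" "y \<in> pos_def_cone"
        using near_one[OF sh, of n] th unfolding y_eq t_def by (simp, simp, simp)
      have "norm (\<phi> y - ?f y) \<le> 4 * (t * norm h)\<^sup>2"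
        using deriv_error[OF sh th] by (simp add: fy) (simp add: y_eq t_def)
      also have "\<dots> \<le> 4 * (t * M)\<^sup>2" using thM t by (simp add: power_mono)
      finally have close: "norm (\<phi> y - ?f y) \<le> 4 * (t * M)\<^sup>2" .
      have "norm (\<phi> y) \<le> 1 + t * M"
      proof -
        have "norm (y - 1) = t * norm h" using t by (simp add: y_eq)
        moreover have "norm (1 + (\<phi> y - 1)) \<le> norm (1::'b) + norm (\<phi> y - 1)" by (rule norm_triangle_ineq)
        ultimately show ?thesis using norm_image_minus_one[OF near(1,2)] thM by simp
      qed
      moreover have "norm (?f h) \<le> norm h"
        using deriv_nonexpansive[OF sh, of 0] f.scaleR[of 0 0] by simp
      then have "t * norm (?f h) \<le> t * norm h" using t by (intro mult_left_mono) simp_all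
      then have "norm (?f y) \<le> 1 + t * M"
      proof -
        have "norm (1 + t *\<^sub>R ?f h) \<le> norm (1::'b) + \<bar>t\<bar> * norm (?f h)"
          by (rule norm_triangle_le) simp
        then show ?thesis using t(1) thM \<open>t * norm (?f h) \<le> t * norm h\<close>
          unfolding fy norm_one by linarith
      qed
      moreover have M0: "M \<ge> 0" by (simp add: M_def)
      ultimately have "norm (\<phi> y ^ (4 ^ n) - ?f y ^ (4 ^ n))
          \<le> real (4 ^ n) * (1 + t * M) ^ (4 ^ n) * norm (\<phi> y - ?f y)"
        using t by (intro norm_power_diff_le) simp_all
      also have "\<dots> \<le> real (4 ^ n) * exp M * (4 * (t * M)\<^sup>2)"
      proof -
        \<comment> \<open>Since \<open>t\<close> is the reciprocal of the exponent, the power stays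
          below \<open>exp M\<close> for every \<open>n\<close>.\<close>
        have "(1 + t * M) ^ (4 ^ n) \<le> exp (t * M) ^ (4 ^ n)"
          using t M0 by (intro power_mono exp_ge_add_one_self) simp_all
        also have "\<dots> = exp M"
          using t by (simp add: exp_of_nat_mult[symmetric] mult.assoc[symmetric])
        finally show ?thesis using close t(1) M0 by (intro mult_mono) simp_all
      qed
      also have "\<dots> = (4 ^ n * t) * (t * (exp M * 4 * M\<^sup>2))" by (simp add: power2_eq_square)
      finally show "norm (\<phi> x - ?f x) \<le> (1/4) ^ n * (exp M * 4 * M\<^sup>2)"
        using power_four_power[OF near(3), of n] f_pow[OF near(1), of n] y(2) t(2)
        by (simp add: t_def)
    qed simp
  qed
  then show ?thesis using LIMSEQ_unique[OF tendsto_const] by fastforce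
qed

text \<open>A positive lower bound \<open>d\<close> of \<open>x\<close> rescales it above the unit,
  and both sides are homogeneous.\<close>

lemma (in cone_map) eq_deriv:
  assumes f: "unital_positive_map (cone_deriv \<phi>)"
    and square: "\<And>h. star h = h \<Longrightarrow> cone_deriv \<phi> (h * h) = cone_deriv \<phi> h * cone_deriv \<phi> h"
    and x: "x \<in> pos_def_cone"
  shows "\<phi> x = cone_deriv \<phi> x"
proof -
  interpret f: unital_positive_map "cone_deriv \<phi>" by fact
  obtain d where d: "d > 0" "nonneg (x - of_real d)" using x pos_def_cone_iff_bounded_below by blast
  let ?y = "(1/d) *\<^sub>R x"
  have "?y - 1 = (1/d) *\<^sub>R (x - of_real d)" using d(1) by (simp add: of_real_def scaleR_diff_right)
  then have "nonneg (?y - 1)" using d nonneg_scaleR[OF d(2), of "1/d"] by simp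
  then have "\<phi> ?y = cone_deriv \<phi> ?y" by (intro eq_deriv_ge_one f square)
  moreover have "\<phi> ?y = (1/d) *\<^sub>R \<phi> x" using x d(1) by (intro homogeneous) simp_all
  moreover have "cone_deriv \<phi> ?y = (1/d) *\<^sub>R cone_deriv \<phi> x"
    using nonneg_star[OF pos_def_cone_nonneg[OF x]] by (rule f.scaleR)
  ultimately show ?thesis using d(1) by simp
qed

lemma cone_deriv_unital_positive:
  assumes phi: "cone_map \<phi>" and psi: "cone_map \<psi>"
    and l: "\<And>x. x \<in> pos_def_cone \<Longrightarrow> \<psi> (\<phi> x) = x" and r: "\<And>x. x \<in> pos_def_cone \<Longrightarrow> \<phi> (\<psi> x) = x"
  shows "unital_positive_map (cone_deriv \<phi>)"
proof -
  interpret \<phi>: cone_map \<phi> by fact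
  interpret \<psi>: cone_map \<psi> by fact
  let ?f = "cone_deriv \<phi>" and ?g = "cone_deriv \<psi>"
  let ?S = "{h::'a. star h = h}" and ?T = "{h::'b. star h = h}"
  have gf: "?g (?f h) = h" if "star h = h" for h using cone_deriv_inverse[OF phi psi l that] .
  have fg: "?f (?g k) = k" if "star k = k" for k using cone_deriv_inverse[OF psi phi r that] .
  have f0: "?f 0 = 0"
  proof -
    have "cone_quotient \<phi> 0 = (\<lambda>_. 0)" by (rule ext) (simp add: cone_quotient_def \<phi>.unital)
    then show ?thesis using \<phi>.deriv_tendsto[of 0] by (simp add: LIMSEQ_const_iff)
  qed
  have iso: "norm (?f h - ?f k) = norm (h - k)" if "star h = h" "star k = k" for h k
    using \<phi>.deriv_nonexpansive[OF that] \<psi>.deriv_nonexpansive[of "?f h" "?f k"] that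
    by (simp add: \<phi>.deriv_star gf)
  have pair: "isometric_pair ?S ?T ?f ?g"
    by (simp add: isometric_pair_def \<phi>.deriv_star \<psi>.deriv_star gf fg iso)
  have add: "?f (h + k) = ?f h + ?f k" if "star h = h" "star k = k" for h k
    using mazur_ulam_additive[OF subspace_selfadjoint subspace_selfadjoint pair f0] that by simp
  show ?thesis
  proof
    fix h :: 'a and r :: real assume "star h = h"
    then show "?f (r *\<^sub>R h) = r *\<^sub>R ?f h"
      using additive_nonexpansive_homogeneous[OF subspace_selfadjoint, of ?f h r] add iso[of _ 0] f0
      by simp
  next
    show "?f 1 = 1" using \<phi>.deriv_translation[of 0 1] f0 by simp
  next
    fix h :: 'a assume "nonneg h"
    then show "nonneg (?f h)" using \<phi>.deriv_mono[of 0 h] f0 by (simp add: nonneg_star)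
  qed (simp_all add: add \<phi>.deriv_star)
qed

section \<open>Complex linear extension\<close>

definition re_part :: "'a::unital_cstar_algebra \<Rightarrow> 'a" where
  "re_part a = (1/2) *\<^sub>R (a + star a)"

text \<open>The factor comes from \<open>1 / (2 * \<i>) = - \<i> / 2\<close>.\<close>

definition im_part :: "'a::unital_cstar_algebra \<Rightarrow> 'a" where
  "im_part a = (- (1/2)) *\<^sub>R (imag_unit * (a - star a))"

lemma star_imag_unit_mult: "star (imag_unit * q) = - (imag_unit * star (q :: 'a::unital_cstar_algebra))"
  by (simp add: star_mult star_imag_unit) (rule imag_unit_commutes)

lemma star_re_part: "star (re_part a) = re_part a"
  by (simp add: re_part_def star_scaleR star_add star_star add.commute)

lemma star_im_part: "star (im_part a) = im_part a"
  by (simp add: im_part_def star_scaleR star_imag_unit_mult star_diff star_star algebra_simps)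

lemma re_im_parts: "a = re_part a + imag_unit * im_part a"
proof -
  have "imag_unit * im_part a = (1/2) *\<^sub>R (a - star a)"
    by (simp add: im_part_def imag_unit_square_assoc scaleR_diff_right)
  then have "re_part a + imag_unit * im_part a = (1/2) *\<^sub>R a + (1/2) *\<^sub>R a"
    by (simp add: re_part_def algebra_simps)
  then show ?thesis by (simp flip: scaleR_add_left)
qed

lemma parts_unique:
  assumes "star p = p" "star q = q"
  shows "re_part (p + imag_unit * q) = p" "im_part (p + imag_unit * q) = q"
proof -
  have s: "star (p + imag_unit * q) = p - imag_unit * q"
    by (simp add: star_add star_imag_unit_mult assms)
  show "re_part (p + imag_unit * q) = p"
    unfolding re_part_def s by (simp flip: scaleR_2)
  have "p + imag_unit * q - (p - imag_unit * q) = imag_unit * (2 *\<^sub>R q)"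
    by (simp add: scaleR_2 distrib_left)
  then show "im_part (p + imag_unit * q) = q"
    unfolding im_part_def s by (simp add: imag_unit_square_assoc)
qed

definition complex_extension :: "('a::unital_cstar_algebra \<Rightarrow> 'b::unital_cstar_algebra) \<Rightarrow> 'a \<Rightarrow> 'b" where
  "complex_extension f a = f (re_part a) + imag_unit * f (im_part a)"

lemma complex_extension_parts:
  "star p = p \<Longrightarrow> star q = q \<Longrightarrow> complex_extension f (p + imag_unit * q) = f p + imag_unit * f q"
  by (simp add: complex_extension_def parts_unique)

lemma selfadjoint_parts_cases:
  obtains p q where "star p = p" "star q = q" "a = p + imag_unit * q"
  using star_re_part star_im_part re_im_parts by metis

lemma jordan_product_eq: "jordan_product a b = (1/2) *\<^sub>R (a * b + b * a)"
  using scaleR_eq_scaleC[of "1/2" "a * b + b * a"] by (simp add: jordan_product_def)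

lemma complex_extension_inverse:
  assumes "\<And>h. star h = h \<Longrightarrow> g (f h) = h" "\<And>h. star h = h \<Longrightarrow> star (f h) = f h"
  shows "complex_extension g (complex_extension f a) = a"
proof (cases a rule: selfadjoint_parts_cases)
  case (1 p q)
  then show ?thesis by (simp add: complex_extension_parts assms)
qed

lemma jordan_star_iso_complex_extension:
  assumes f: "unital_positive_map f"
    and square: "\<And>h. star h = h \<Longrightarrow> f (h * h) = f h * f h"
    and gf: "\<And>h. star h = h \<Longrightarrow> g (f h) = h" and fg: "\<And>k. star k = k \<Longrightarrow> f (g k) = k"
    and g: "\<And>k. star k = k \<Longrightarrow> star (g k) = g k"
  shows "jordan_star_iso (complex_extension f)"
proof -
  interpret f: unital_positive_map f by fact
  let ?J = "complex_extension f"
  have anti: "star (h * k + k * h) = h * k + k * h" if "star h = h" "star k = k" for h k :: 'a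
    using that by (simp add: star_add star_mult add.commute)
  \<comment> \<open>Polarisation: the square rule at \<open>h + k\<close> isolates the
    anticommutator, which is selfadjoint although \<open>h * k\<close> need not be.\<close>
  have f_anti: "f (h * k + k * h) = f h * f k + f k * f h" if h: "star h = h" and k: "star k = k" for h k
  proof -
    have hk: "star (h + k) = h + k" using h k by (simp add: star_add)
    have "(h + k) * (h + k) = h * h + (h * k + k * h) + k * k" by (simp add: algebra_simps)
    then have "f (h + k) * f (h + k) = f (h * h + (h * k + k * h) + k * k)"
      using square[OF hk] by simp
    also have "\<dots> = f h * f h + f (h * k + k * h) + f k * f k"
      using h k anti[OF h k] by (simp only: f.additive star_add star_mult square)
    finally show ?thesis by (simp add: f.additive h k algebra_simps)
  qed
  have add: "?J (a + b) = ?J a + ?J b" for a b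
  proof (cases a rule: selfadjoint_parts_cases)
    case a: (1 p q)
    show ?thesis
    proof (cases b rule: selfadjoint_parts_cases)
      case b: (1 r s)
      have "a + b = (p + r) + imag_unit * (q + s)" by (simp add: a b algebra_simps)
      then have "?J (a + b) = f (p + r) + imag_unit * f (q + s)"
        using a b by (simp only: complex_extension_parts star_add)
      then show ?thesis using a b by (simp add: complex_extension_parts f.additive algebra_simps)
    qed
  qed
  have scale: "?J (c *\<^sub>C a) = c *\<^sub>C ?J a" for c a
  proof (cases a rule: selfadjoint_parts_cases)
    case a: (1 p q)
    have "c *\<^sub>C a = (Re c *\<^sub>R p - Im c *\<^sub>R q) + imag_unit * (Re c *\<^sub>R q + Im c *\<^sub>R p)"
      by (simp add: scaleC_eq a imag_unit_square_assoc algebra_simps)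
    then have "?J (c *\<^sub>C a) = f (Re c *\<^sub>R p - Im c *\<^sub>R q) + imag_unit * f (Re c *\<^sub>R q + Im c *\<^sub>R p)"
      using a by (simp only: complex_extension_parts star_add star_diff star_scaleR)
    also have "\<dots> = c *\<^sub>C ?J a"
      using a by (simp add: complex_extension_parts f.additive f.diff f.scaleR star_scaleR scaleC_eq
          imag_unit_square_assoc algebra_simps)
    finally show ?thesis .
  qed
  have scaleR: "?J (r *\<^sub>R a) = r *\<^sub>R ?J a" for r a
    using scale[of "of_real r" a] by (simp add: scaleR_eq_scaleC)
  have star: "?J (star a) = star (?J a)" for a
  proof (cases a rule: selfadjoint_parts_cases)
    case a: (1 p q)
    have "star a = p + imag_unit * (- q)" by (simp add: a star_add star_imag_unit_mult)
    then have "?J (star a) = f p + imag_unit * f (- q)"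
      using a by (simp only: complex_extension_parts star_minus)
    then show ?thesis
      using a by (simp add: complex_extension_parts f.minus f.selfadjoint star_add star_imag_unit_mult)
  qed
  \<comment> \<open>Since \<open>imag_unit\<close> is central, the real and imaginary parts of an
    anticommutator are built from anticommutators of the parts, so \<open>f_anti\<close> applies to
    each.\<close>
  have expand: "(x + imag_unit * y) * (u + imag_unit * v) + (u + imag_unit * v) * (x + imag_unit * y)
      = ((x * u + u * x) - (y * v + v * y)) + imag_unit * ((x * v + v * x) + (y * u + u * y))"
    for x y u v :: "'c::unital_cstar_algebra"
  proof -
    have i: "a * (imag_unit * b) = imag_unit * (a * b)" for a b :: 'c
      by (metis imag_unit_commutes mult.assoc)
    show ?thesis by (simp add: distrib_left distrib_right i[of x] i[of y] i[of u] i[of v] mult.assoc imag_unit_square_assoc)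
  qed
  have jordan: "?J (a * b + b * a) = ?J a * ?J b + ?J b * ?J a" for a b
  proof (cases a rule: selfadjoint_parts_cases)
    case a: (1 p q)
    show ?thesis
    proof (cases b rule: selfadjoint_parts_cases)
      case b: (1 r s)
      have "?J (a * b + b * a) = f ((p * r + r * p) - (q * s + s * q))
          + imag_unit * f ((p * s + s * p) + (q * r + r * q))"
        unfolding a(3) b(3) expand using a b anti
        by (intro complex_extension_parts) (simp_all only: star_add star_diff)
      also have "\<dots> = ((f p * f r + f r * f p) - (f q * f s + f s * f q))
          + imag_unit * ((f p * f s + f s * f p) + (f q * f r + f r * f q))"
        using a b anti by (simp only: f.additive f.diff f_anti)
      also have "\<dots> = ?J a * ?J b + ?J b * ?J a"
        using a b by (simp only: complex_extension_parts expand)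
      finally show ?thesis .
    qed
  qed
  have "complex_extension g (?J a) = a" for a by (rule complex_extension_inverse[OF gf f.selfadjoint])
  moreover have "?J (complex_extension g b) = b" for b by (rule complex_extension_inverse[OF fg g])
  ultimately have "bij ?J" by (intro o_bij[of "complex_extension g"] ext) simp_all
  moreover have "?J (jordan_product a b) = jordan_product (?J a) (?J b)" for a b
    by (simp only: jordan_product_eq scaleR jordan)
  ultimately show ?thesis unfolding jordan_star_iso_def by (simp add: add scale star)
qed

section \<open>Jordan isomorphisms preserve the norm of selfadjoint elements\<close>

locale jordan_iso =
  fixes J :: "'a::unital_cstar_algebra \<Rightarrow> 'b::unital_cstar_algebra"
  assumes jordan: "jordan_star_iso J"
begin

lemma bij: "bij J" and add: "J (a + b) = J a + J b"
  and jordan_product: "J (jordan_product a b) = jordan_product (J a) (J b)"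
  and star: "J (star a) = star (J a)"
  using jordan by (simp_all add: jordan_star_iso_def)

lemma scaleR: "J (r *\<^sub>R a) = r *\<^sub>R J a"
  using jordan by (simp add: jordan_star_iso_def scaleR_eq_scaleC)

lemma diff: "J (a - b) = J a - J b"
  using add[of "a - b" b] by (simp add: algebra_simps)

lemma square: "J (a * a) = J a * J a"
  using jordan_product[of a a] by (simp add: jordan_product_eq flip: scaleR_2)

text \<open>Surjectivity gives \<open>a\<close> with \<open>J a = 1\<close>; applying
  \<open>J\<close> to the Jordan product of 1 and \<open>a\<close> then shows that
  \<open>J 1\<close> is 1.\<close>

lemma one: "J 1 = 1"
proof -
  obtain a where a: "J a = 1" using bij by (metis bij_pointE)
  have "J a = jordan_product (J 1) (J a)"
    using jordan_product[of 1 a] by (simp add: jordan_product_eq flip: scaleR_2)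
  then show ?thesis using a by (simp add: jordan_product_eq flip: scaleR_2)
qed

text \<open>\<open>y * x * y\<close> is a Jordan polynomial, so it is respected although
  \<open>J\<close> need not preserve products.\<close>

lemma triple: "J (y * x * y) = J y * J x * J y"
proof -
  have eq: "b * a * b = 2 *\<^sub>R jordan_product b (jordan_product b a) - jordan_product (b * b) a"
    for a b :: "'c::unital_cstar_algebra"
    by (simp add: jordan_product_eq algebra_simps flip: scaleR_add_left)
  show ?thesis unfolding eq by (simp only: diff scaleR jordan_product square)
qed

text \<open>Nonnegative elements are squares of selfadjoint ones, and \<open>J\<close> preserves
  squares and real scalars. Hence it preserves order bounds by scalars, which determine the norm of
  a selfadjoint element.\<close>

lemma norm_le:
  assumes h: "star h = h"
  shows "norm (J h) \<le> norm h"
proof -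
  have pos: "nonneg (J x)" if x: "nonneg x" for x
  proof -
    obtain s where s: "nonneg s" "s * s = x" using nonneg_sqrt[OF x] by metis
    have "star (J s) = J s" using star[of s] nonneg_star[OF s(1)] by simp
    then show ?thesis using nonneg_square[of "J s"] square[of s] s(2) by simp
  qed
  have "J (of_real r) = of_real r" for r by (simp add: of_real_def scaleR one)
  then show ?thesis
    using pos[OF nonneg_of_real_minus[OF h order_refl]] pos[OF nonneg_of_real_plus[OF h order_refl]]
    by (intro norm_le_of_nonneg) (simp_all add: add diff)
qed

lemma inverse: "jordan_iso (inv J)"
proof
  have r: "J (inv J b) = b" and l: "inv J (J a) = a" for a b
    using bij by (simp_all add: bij_is_surj surj_f_inv_f bij_is_inj)
  show "jordan_star_iso (inv J)"
    unfolding jordan_star_iso_def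
  proof (intro conjI allI)
    show "bij (inv J)" using bij by (rule bij_imp_bij_inv)
    show "inv J (a + b) = inv J a + inv J b" for a b using l[of "inv J a + inv J b"] by (simp add: add r)
    show "inv J (c *\<^sub>C a) = c *\<^sub>C inv J a" for c a
      using l[of "c *\<^sub>C inv J a"] jordan by (simp add: jordan_star_iso_def r)
    show "inv J (jordan_product a b) = jordan_product (inv J a) (inv J b)" for a b
      using l[of "jordan_product (inv J a) (inv J b)"] by (simp add: jordan_product r)
    show "inv J (star a) = star (inv J a)" for a using l[of "star (inv J a)"] by (simp add: star r)
  qed
qed

lemma norm_eq:
  assumes h: "star h = h"
  shows "norm (J h) = norm h"
proof (rule antisym)
  show "norm (J h) \<le> norm h" by (rule norm_le[OF h])
  have "norm (inv J (J h)) \<le> norm (J h)"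
    using star[of h] h by (intro jordan_iso.norm_le[OF inverse]) simp
  then show "norm h \<le> norm (J h)" using bij by (simp add: bij_is_inj)
qed

end

section \<open>The extension and its converse\<close>

lemma norm_preserver_extends:
  fixes \<phi> :: "'a::unital_cstar_algebra \<Rightarrow> 'b::unital_cstar_algebra"
  assumes "norm_preserver \<phi>"
  shows "\<exists>J. jordan_star_iso J \<and> (\<forall>x\<in>pos_def_cone. \<phi> x = J x)"
proof -
  interpret norm_preserver \<phi> by fact
  interpret \<phi>: cone_map \<phi> by (rule cone_map)
  let ?\<psi> = "inv_into pos_def_cone \<phi>"
  interpret \<psi>: cone_map ?\<psi> by (rule cone_map_inverse)
  let ?f = "cone_deriv \<phi>" and ?g = "cone_deriv ?\<psi>"
  have l: "?\<psi> (\<phi> x) = x" if "x \<in> pos_def_cone" for x using that inj_on_cone by simp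
  have r: "\<phi> (?\<psi> y) = y" if "y \<in> pos_def_cone" for y using that onto by (simp add: f_inv_into_f)
  have gf: "?g (?f h) = h" if "star h = h" for h
    by (rule cone_deriv_inverse[OF cone_map cone_map_inverse l that])
  have fg: "?f (?g k) = k" if "star k = k" for k
    by (rule cone_deriv_inverse[OF cone_map_inverse cone_map r that])
  have f: "unital_positive_map ?f"
    by (rule cone_deriv_unital_positive[OF cone_map cone_map_inverse l r])
  have g: "unital_positive_map ?g"
    by (rule cone_deriv_unital_positive[OF cone_map_inverse cone_map r l])
  have square: "?f (h * h) = ?f h * ?f h" if "star h = h" for h
    by (rule positive_inverse_pair_square[OF f g gf fg that])
  have "\<phi> x = complex_extension ?f x" if x: "x \<in> pos_def_cone" for x
  proof -
    have "star x = x" using x by (simp add: pos_def_cone_nonneg nonneg_star)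
    moreover have "?f 0 = 0" using unital_positive_map.scaleR[OF f, of 0 0] by simp
    ultimately have "complex_extension ?f x = ?f x"
      using complex_extension_parts[of x 0 ?f] by simp
    then show ?thesis using \<phi>.eq_deriv[OF f square x] by simp
  qed
  moreover have "jordan_star_iso (complex_extension ?f)"
    by (rule jordan_star_iso_complex_extension[OF f square gf fg \<psi>.deriv_star])
  ultimately show ?thesis by blast
qed

theorem corollary3p5:
  shows "(\<forall>\<phi> :: 'a::unital_cstar_algebra \<Rightarrow> 'b::unital_cstar_algebra.
            \<phi> ` (pos_def_cone :: 'a set) = (pos_def_cone :: 'b set) \<longrightarrow>
            (\<forall>x \<in> pos_def_cone. \<forall>y \<in> pos_def_cone.
               norm (\<phi> y * \<phi> x * \<phi> y) = norm (y * x * y)) \<longrightarrow>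
            (\<exists>J :: 'a \<Rightarrow> 'b. jordan_star_iso J \<and> (\<forall>x \<in> pos_def_cone. \<phi> x = J x)))
         \<and> (\<forall>J :: 'a \<Rightarrow> 'b. jordan_star_iso J \<longrightarrow>
              (\<forall>x \<in> pos_def_cone. \<forall>y \<in> pos_def_cone.
                 norm (J y * J x * J y) = norm (y * x * y)))"
proof (intro conjI allI impI ballI)
  fix \<phi> :: "'a \<Rightarrow> 'b"
  assume "\<phi> ` pos_def_cone = pos_def_cone"
    and "\<forall>x \<in> pos_def_cone. \<forall>y \<in> pos_def_cone. norm (\<phi> y * \<phi> x * \<phi> y) = norm (y * x * y)"
  then have "norm_preserver \<phi>" by unfold_locales auto
  then show "\<exists>J. jordan_star_iso J \<and> (\<forall>x \<in> pos_def_cone. \<phi> x = J x)"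
    by (rule norm_preserver_extends)
next
  fix J :: "'a \<Rightarrow> 'b" and x y :: 'a
  assume "jordan_star_iso J" and x: "x \<in> pos_def_cone" and y: "y \<in> pos_def_cone"
  then interpret jordan_iso J by unfold_locales
  have "star (y * x * y) = y * x * y"
    using x y by (simp add: star_mult pos_def_cone_nonneg nonneg_star mult.assoc)
  then show "norm (J y * J x * J y) = norm (y * x * y)" using norm_eq triple by metis
qed

end
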